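(* Let $\alpha\ge\tfrac12$ and let $p_1,q_1,p_2,q_2,p,q\in[1,\infty]$ satisfy $\big(\tfrac1p,\tfrac1q\big)=\big(\tfrac1{p_1},\tfrac1{q_1}\big)+\big(\tfrac1{p_2},\tfrac1{q_2}\big)-(1,1)$. Then there is a constant $C>0$ (depending only on $\alpha$ and the exponents) such that for all $f_1\in(L^{p_1},\ell^{q_1})(\mathbb{R}_+,*_\alpha)$ and $f_2\in(L^{p_2},\ell^{q_2})(\mathbb{R}_+,*_\alpha)$ one has $f_1*_\alpha f_2\in(L^p,\ell^q)(\mathbb{R}_+,*_\alpha)$ and $\|f_1*_\alpha f_2\|_{p,q}\le C\,\|f_1\|_{p_1,q_1}\|f_2\|_{p_2,q_2}.$
   Context: Fix $\alpha\geq\tfrac12$. The Bessel–Kingman hypergroup is $(\mathbb{R}_+,*_\alpha)$ with Haar measure $\omega_\alpha(dz)=z^{2\alpha+1}dz$ and, for $x,y>0$, $\varepsilon_x*_\alpha\varepsilon_y(f)=\int_{|x-y|}^{x+y}K_\alpha(x,y,z)f(z)z^{2\alpha+1}dz$ with $K_\alpha(x,y,z)=C_\Gamma\frac{[(z^2-(x-y)^2)((x+y)^2-z^2)]^{\alpha-1/2}}{(xyz)^{2\alpha}}$, $C_\Gamma=\frac{\Gamma(\alpha+1)}{\Gamma(1/2)\Gamma(\alpha+1/2)2^{2\alpha-1}}$; $\varepsilon_0$ is the identity; the involution is the identity. Translation: $\tau_yf(x)=\varepsilon_x*_\alpha\varepsilon_y(f)$, and the convolution of functions is $f_1*_\alpha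 f_2(x)=\int_{\mathbb{R}_+}f_1(y)\,\tau_xf_2(y)\,d\omega_\alpha(y)$. Let $I_n=[n-1,n)$ and $\omega_n=\omega_\alpha(I_n)$. For $1\le p,q<\infty$, $\|f\|_{p,q}=\big(\sum_{n\ge1}\omega_n\big(\frac1{\omega_n}\int_{I_n}|f|^pd\omega_\alpha\big)^{q/p}\big)^{1/q}$, with $\|f\|_{\infty,q}=(\sum_n\omega_n\sup_{I_n}|f|^q)^{1/q}$, $\|f\|_{p,\infty}=\sup_n(\frac1{\omega_n}\int_{I_n}|f|^pd\omega_\alpha)^{1/p}$, $\|f\|_{\infty,\infty}=\|f\|_\infty$; $(L^p,\ell^q)(\mathbb{R}_+,*_\alpha)$ is the space of measurable $f$ with $\|f\|_{p,q}<\infty$. *)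

theory Defs
  imports "HOL-Analysis.Analysis"
begin

definition epow :: "ennreal \<Rightarrow> real \<Rightarrow> ennreal" where
  "epow x r = (if x = \<infinity> then \<infinity> else ennreal (enn2real x powr r))"

definition inv_exp :: "ennreal \<Rightarrow> real" where
  "inv_exp p = (if p = \<infinity> then 0 else 1 / enn2real p)"

text \<open>Haar measure omega_alpha(dz) = z^(2 alpha+1) dz on R_+ (as a measure on the real line,
  supported on [0, infinity)).\<close>
definition bk_measure :: "real \<Rightarrow> real measure" where
  "bk_measure \<alpha> = density lebesgue (\<lambda>z. ennreal (indicator {0..} z * z powr (2 * \<alpha> + 1)))"

definition C_Gamma :: "real \<Rightarrow> real" where
  "C_Gamma \<alpha> = Gamma (\<alpha> + 1) / (Gamma (1/2) * Gamma (\<alpha> + 1/2) * 2 powr (2 * \<alpha> - 1))"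

definition bk_kernel :: "real \<Rightarrow> real \<Rightarrow> real \<Rightarrow> real \<Rightarrow> real" where
  "bk_kernel \<alpha> x y z = C_Gamma \<alpha> *
     ((z\<^sup>2 - (x - y)\<^sup>2) * ((x + y)\<^sup>2 - z\<^sup>2)) powr (\<alpha> - 1/2) / (x * y * z) powr (2 * \<alpha>)"

text \<open>Generalized translation: hyp_trans alpha f x y = (eps_x * eps_y)(f), for x, y >= 0.
  Hence tau_y f (x) = hyp_trans alpha f x y.\<close>
definition hyp_trans :: "real \<Rightarrow> (real \<Rightarrow> complex) \<Rightarrow> real \<Rightarrow> real \<Rightarrow> complex" where
  "hyp_trans \<alpha> f x y =
     (if x = 0 then f y else if y = 0 then f x else
      integral\<^sup>L lebesgue (\<lambda>z. (indicator {\<bar>x - y\<bar>..x + y} z * bk_kernel \<alpha> x y z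
                                 * z powr (2 * \<alpha> + 1)) *\<^sub>R f z))"

text \<open>The same translation applied to a nonnegative (extended) function, via the
  nonnegative integral (used to express absolute convergence of the convolution).\<close>
definition hyp_trans_nn :: "real \<Rightarrow> (real \<Rightarrow> ennreal) \<Rightarrow> real \<Rightarrow> real \<Rightarrow> ennreal" where
  "hyp_trans_nn \<alpha> g x y =
     (if x = 0 then g y else if y = 0 then g x else
      (\<integral>\<^sup>+ z. ennreal (indicator {\<bar>x - y\<bar>..x + y} z * bk_kernel \<alpha> x y z
                                 * z powr (2 * \<alpha> + 1)) * g z \<partial>lebesgue))"

text \<open>Convolution: (f1 * f2)(x) = int f1(y) tau_x f2(y) d omega(y), for x >= 0
  (set to 0 for x < 0, where it is irrelevant).\<close>
definition bk_conv :: "real \<Rightarrow> (real \<Rightarrow> complex) \<Rightarrow> (real \<Rightarrow> complex) \<Rightarrow> real \<Rightarrow> complex" where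
  "bk_conv \<alpha> f1 f2 x =
     (if x < 0 then 0 else integral\<^sup>L (bk_measure \<alpha>) (\<lambda>y. f1 y * hyp_trans \<alpha> f2 y x))"

text \<open>Cells: cell n = [n, n+1) is the interval I_{n+1} of the paper (0-indexed here).\<close>
definition cell :: "nat \<Rightarrow> real set" where
  "cell n = {real n..<real n + 1}"

definition cell_meas :: "real \<Rightarrow> nat \<Rightarrow> ennreal" where
  "cell_meas \<alpha> n = emeasure (bk_measure \<alpha>) (cell n)"

definition local_norm :: "real \<Rightarrow> ennreal \<Rightarrow> (real \<Rightarrow> complex) \<Rightarrow> nat \<Rightarrow> ennreal" where
  "local_norm \<alpha> p f n =
     (if p = \<infinity> then (SUP x\<in>cell n. ennreal (norm (f x)))
      else epow ((\<integral>\<^sup>+ x\<in>cell n. ennreal (norm (f x) powr enn2real p) \<partial>bk_measure \<alpha>)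
                  / cell_meas \<alpha> n) (1 / enn2real p))"

definition amalgam_norm :: "real \<Rightarrow> ennreal \<Rightarrow> ennreal \<Rightarrow> (real \<Rightarrow> complex) \<Rightarrow> ennreal" where
  "amalgam_norm \<alpha> p q f =
     (if q = \<infinity> then (SUP n. local_norm \<alpha> p f n)
      else epow (\<Sum>n. cell_meas \<alpha> n * epow (local_norm \<alpha> p f n) (enn2real q)) (1 / enn2real q))"

definition in_amalgam :: "real \<Rightarrow> ennreal \<Rightarrow> ennreal \<Rightarrow> (real \<Rightarrow> complex) \<Rightarrow> bool" where
  "in_amalgam \<alpha> p q f \<longleftrightarrow> f \<in> borel_measurable lebesgue \<and> amalgam_norm \<alpha> p q f < \<infinity>"

end

theory Submission
  imports Defs
begin

text \<open>
  Both levels of the amalgam norm are handled by one Young inequality for a nonnegative kernel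
  \<open>K x y z\<close> whose three marginal integrals are all at most \<open>L\<close>. With \<open>X = k + 1\<close>, \<open>Y = m + 1\<close>,
  \<open>Z = n + 1\<close>, the Bessel--Kingman kernel averaged in one variable over a cell is at most a constant
  times the weight \<open>W(X, Y, Z) = max(X, Y, Z)\<^bsup>1 - 2\<alpha>\<^esup> / (X Y Z)\<close>, restricted to triples satisfying the
  triangle inequalities. This weight is symmetric, so Young's inequality for the normalised Haar
  measures on three cells together with Minkowski's inequality bounds the local norms of the
  convolution by a discrete convolution of the local norms, with kernel \<open>W\<close>. Since
  \<open>Z\<^bsup>2\<alpha> + 1\<^esup> W \<le> Z / (X Y)\<close>, all marginals of \<open>W\<close> with respect to the cell masses are bounded, and
  Young's inequality applies a second time.
\<close>

section \<open>Extended powers, Holder and Minkowski inequalities\<close>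

text \<open>The obstacle is the origin. As \<open>x\<close> or \<open>y\<close> tends to 0, the
  kernel concentrates to a point mass, so no pointwise bound by \<open>W\<close> can hold on the
  first cell. Young's inequality asks only for marginals, and averaging over one variable is
  harmless there because the mass of the kernel is bounded uniformly in the other two. Away from the
  first cell a point and its shifted index agree up to a factor 2, and the shift keeps
  \<open>W\<close> finite at index 0. The hypothesis on \<alpha> gives
  \<open>\<alpha> - 1/2 >= 0\<close> and \<open>1 - 2 * \<alpha> <= 0\<close>; these signs fix the
  direction of every monotonicity step. Young's inequality is proved without loss, so the final
  constant \<open>6 * tri_const \<alpha>\<close> depends on \<alpha> alone: \<open>tri_const\<close>
  comes from the cells, 6 from the sequences. All estimates are made for nonnegative majorants in
  \<open>ennreal\<close>, where convergence is no issue; absolute convergence of the complex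
  convolution is read off from finite norms afterwards.\<close>

lemma epow_0 [simp]: "epow 0 r = 0"
  by (simp add: epow_def)

lemma epow_top [simp]: "epow \<infinity> r = \<infinity>" "epow top r = top"
  by (simp_all add: epow_def)

lemma epow_ennreal: "0 \<le> x \<Longrightarrow> epow (ennreal x) r = ennreal (x powr r)"
  by (simp add: epow_def)

lemma epow_eq_0_iff [simp]: "epow x r = 0 \<longleftrightarrow> x = 0"
  by (cases x) (auto simp: epow_ennreal)

lemma epow_eq_top_iff [simp]: "epow x r = top \<longleftrightarrow> x = top"
  by (cases x) (auto simp: epow_ennreal)

lemma epow_one_right [simp]: "epow x 1 = x"
  by (cases x) (auto simp: epow_ennreal)

text \<open>Free of side conditions because \<open>epow\<close> fixes 0 and \<infinity> for every
  exponent, including zero and negative ones. The same holds for \<open>epow_epow\<close> and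
  \<open>epow_add\<close>. The price is that \<open>epow x 0 = 1\<close> only for 0 < x <
  \<infinity>, which explains several case distinctions below.\<close>

lemma epow_mult: "epow (x * y) r = epow x r * epow y r"
proof (cases "x = 0 \<or> y = 0")
  case False
  then show ?thesis
    by (cases x; cases y)
       (auto simp: epow_ennreal ennreal_mult[symmetric] powr_mult ennreal_mult_eq_top_iff
             ennreal_top_mult ennreal_mult_top)
qed auto

lemma epow_epow: "epow (epow x r) s = epow x (r * s)"
  by (cases x) (auto simp: epow_ennreal powr_powr)

lemma epow_add: "epow x (r + s) = epow x r * epow x s"
  by (cases x) (auto simp: epow_ennreal powr_add ennreal_mult)

lemma epow_mono: "x \<le> y \<Longrightarrow> 0 \<le> r \<Longrightarrow> epow x r \<le> epow y r"
  by (cases x; cases y) (auto simp: epow_ennreal powr_mono2 top_unique)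

lemma epow_measurable [measurable]: "(\<lambda>x. epow x r) \<in> borel_measurable borel"
  unfolding epow_def by measurable

text \<open>The tangent bound \<open>ln r <= r - 1\<close> is applied to each variable divided by
  the arithmetic mean \<open>L\<close>; the weighted right sides then add up to 0.\<close>

lemma weighted_AM_GM3:
  fixes a b c s t u :: real
  assumes "0 \<le> a" "0 \<le> b" "0 \<le> c" "a + b + c = 1" "0 < s" "0 < t" "0 < u"
  shows "s powr a * t powr b * u powr c \<le> a * s + b * t + c * u"
proof -
  define L where "L = a * s + b * t + c * u"
  have L: "0 < L"
  proof -
    have "0 < a \<or> 0 < b \<or> 0 < c" using assms by linarith
    then show ?thesis
      unfolding L_def using assms
      by (auto intro: add_pos_nonneg add_nonneg_pos simp: add_pos_nonneg add_nonneg_pos)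
  qed
  have ln_le: "ln (r / L) \<le> r / L - 1" if "0 < r" for r
    using that L by (intro ln_le_minus_one) simp
  have "a * ln (s/L) + b * ln (t/L) + c * ln (u/L) \<le> a * (s/L - 1) + b * (t/L - 1) + c * (u/L - 1)"
    using assms by (intro add_mono mult_left_mono ln_le) auto
  also have "\<dots> = (a * s + b * t + c * u) / L - (a + b + c)"
    by (simp add: algebra_simps add_divide_distrib)
  also have "\<dots> = 0" using L assms by (simp add: L_def)
  finally have "a * ln s + b * ln t + c * ln u \<le> (a + b + c) * ln L"
    using assms(5-7) L by (simp add: ln_div algebra_simps)
  then have "exp (a * ln s + b * ln t + c * ln u) \<le> exp (ln L)"
    using assms by (simp only: mult_1 exp_le_cancel_iff)
  then show ?thesis
    using assms L by (simp add: powr_def exp_add L_def)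
qed

text \<open>Finiteness matters: for \<open>a = 0\<close> and \<open>s = top\<close> the left side
  may be infinite through \<open>epow top 0 = top\<close>, while
  \<open>ennreal 0 * top = 0\<close>.\<close>

lemma weighted_AM_GM3_ennreal:
  fixes s t u :: ennreal
  assumes "0 \<le> a" "0 \<le> b" "0 \<le> c" "a + b + c = 1" "s < top" "t < top" "u < top"
  shows "epow s a * epow t b * epow u c \<le> ennreal a * s + ennreal b * t + ennreal c * u"
proof (cases "s = 0 \<or> t = 0 \<or> u = 0")
  case False
  from assms(5-7) obtain s' t' u' where "s = ennreal s'" "t = ennreal t'" "u = ennreal u'"
    "0 \<le> s'" "0 \<le> t'" "0 \<le> u'"
    by (auto simp: less_top_ennreal)
  with False assms weighted_AM_GM3[of a b c s' t' u'] show ?thesis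
    by (auto simp: epow_ennreal ennreal_mult[symmetric] ennreal_plus[symmetric] simp del: ennreal_plus
          intro!: ennreal_leI)
qed auto

text \<open>Each function is divided by its integral and weighted AM-GM is integrated. Three factors
  are what the splitting in Young's inequality produces; vanishing exponents are allowed, since they
  occur there at the endpoints.\<close>

theorem nn_integral_Holder3:
  assumes [measurable]: "f \<in> borel_measurable M" "g \<in> borel_measurable M" "h \<in> borel_measurable M"
    and exps: "0 \<le> a" "0 \<le> b" "0 \<le> c" "a + b + c = 1"
  shows "(\<integral>\<^sup>+x. epow (f x) a * epow (g x) b * epow (h x) c \<partial>M)
     \<le> epow (\<integral>\<^sup>+x. f x \<partial>M) a * epow (\<integral>\<^sup>+x. g x \<partial>M) b * epow (\<integral>\<^sup>+x. h x \<partial>M) c"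
    (is "?L \<le> epow ?F a * epow ?G b * epow ?H c")
proof (cases "?F = 0 \<or> ?G = 0 \<or> ?H = 0")
  case True
  then have "AE x in M. epow (f x) a * epow (g x) b * epow (h x) c = 0"
    by (auto simp: nn_integral_0_iff_AE)
  then show ?thesis
    by (subst nn_integral_0_iff_AE[THEN iffD2]) (auto elim: AE_mp)
next
  case nz: False
  show ?thesis
  proof (cases "?F = top \<or> ?G = top \<or> ?H = top")
    \<comment> \<open>All three powers are nonzero, and \<open>epow top\<close> is infinite even for
      exponent 0, so the right side is infinite.\<close>
    case True
    with nz have "epow ?F a * epow ?G b * epow ?H c = top"
      by (auto simp: ennreal_mult_eq_top_iff)
    then show ?thesis by simp
  next
    case False
    then have fin: "?F < top" "?G < top" "?H < top" by (auto simp: less_top)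
    have inv: "x * inverse x = 1" if "x \<noteq> 0" "x < top" for x :: ennreal
      using that by (simp add: ennreal_divide_self flip: divide_ennreal_def)
    have inv_fin: "inverse x < top" if "x \<noteq> 0" for x :: ennreal
      using that by (simp add: less_top[symmetric])
    define P where "P = epow ?F a * epow ?G b * epow ?H c"
    have AE_fin: "AE x in M. f x < top \<and> g x < top \<and> h x < top"
      using fin nn_integral_PInf_AE[of f M] nn_integral_PInf_AE[of g M] nn_integral_PInf_AE[of h M]
      by (auto simp: less_top)
    have scale: "epow y r = epow X r * epow (y * inverse X) r" if "X \<noteq> 0" "X < top" for X y r
      by (simp only: epow_mult[symmetric] mult.left_commute[of X y] inv[OF that] mult_1_right)
    have "?L \<le> (\<integral>\<^sup>+x. P * (ennreal a * (f x * inverse ?F) + ennreal b * (g x * inverse ?G)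
             + ennreal c * (h x * inverse ?H)) \<partial>M)"
    proof (rule nn_integral_mono_AE, use AE_fin in eventually_elim)
      case (elim x)
      have "epow (f x) a * epow (g x) b * epow (h x) c =
        P * (epow (f x * inverse ?F) a * epow (g x * inverse ?G) b * epow (h x * inverse ?H) c)"
        using nz fin scale[of ?F "f x" a] scale[of ?G "g x" b] scale[of ?H "h x" c]
        unfolding P_def by (simp add: ac_simps)
      also have "\<dots> \<le> P * (ennreal a * (f x * inverse ?F) + ennreal b * (g x * inverse ?G)
             + ennreal c * (h x * inverse ?H))"
        using elim nz exps by (intro mult_left_mono weighted_AM_GM3_ennreal ennreal_mult_less_top[THEN iffD2])
          (auto simp: inv_fin)
      finally show ?case .
    qed
    also have "\<dots> = P * (ennreal a * (?F * inverse ?F) + ennreal b * (?G * inverse ?G)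
             + ennreal c * (?H * inverse ?H))"
      by (simp add: nn_integral_cmult nn_integral_add nn_integral_multc)
    also have "\<dots> = P * ennreal (a + b + c)"
      using nz fin exps(1-3) by (simp add: inv)
    finally show ?thesis using exps by (simp add: P_def)
  qed
qed

text \<open>The second function is used twice with half its exponent. A constant third function with
  exponent 0 would fail on infinite measures, where \<open>epow top 0 = top\<close>.\<close>

corollary nn_integral_Holder2:
  assumes [measurable]: "f \<in> borel_measurable M" "g \<in> borel_measurable M"
    and exps: "0 \<le> a" "0 \<le> b" "a + b = 1"
  shows "(\<integral>\<^sup>+x. epow (f x) a * epow (g x) b \<partial>M) \<le> epow (\<integral>\<^sup>+x. f x \<partial>M) a * epow (\<integral>\<^sup>+x. g x \<partial>M) b"
  using nn_integral_Holder3[of f M g g a "b/2" "b/2"] exps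
  by (simp add: mult.assoc flip: epow_add)

text \<open>For \<^term>\<open>p = (\<infinity>::ennreal)\<close> this is the pointwise supremum over the space of the measure,
  not the essential supremum.\<close>

definition Lp :: "'a measure \<Rightarrow> ennreal \<Rightarrow> ('a \<Rightarrow> ennreal) \<Rightarrow> ennreal" where
  "Lp M p f = (if p = \<infinity> then (SUP x\<in>space M. f x)
     else epow (\<integral>\<^sup>+x. epow (f x) (enn2real p) \<partial>M) (1 / enn2real p))"

lemma Lp_top: "Lp M top f = (SUP x\<in>space M. f x)"
  by (simp add: Lp_def)

lemma Lp_finite: "p \<noteq> \<infinity> \<Longrightarrow> Lp M p f = epow (\<integral>\<^sup>+x. epow (f x) (enn2real p) \<partial>M) (1 / enn2real p)"
  by (simp add: Lp_def)

lemma epow_Lp: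
  assumes "p \<noteq> \<infinity>" "1 \<le> p"
  shows "epow (Lp M p f) (enn2real p) = (\<integral>\<^sup>+x. epow (f x) (enn2real p) \<partial>M)"
proof -
  have "enn2real p \<noteq> 0" using assms by (auto simp: enn2real_eq_0_iff)
  then show ?thesis using assms by (simp add: Lp_finite epow_epow)
qed

lemma enn2real_ge_1: "p \<noteq> \<infinity> \<Longrightarrow> 1 \<le> p \<Longrightarrow> 1 \<le> enn2real p"
  by (cases p) auto

lemma Lp_mono: "(\<And>x. x \<in> space M \<Longrightarrow> f x \<le> g x) \<Longrightarrow> Lp M p f \<le> Lp M p g"
  unfolding Lp_def by (auto intro!: SUP_mono' epow_mono nn_integral_mono SUP_mono)

lemma Lp_mono_AE:
  "p \<noteq> \<infinity> \<Longrightarrow> AE x in M. f x \<le> g x \<Longrightarrow> Lp M p f \<le> Lp M p g"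
  unfolding Lp_def by (auto intro!: epow_mono nn_integral_mono_AE elim!: AE_mp)

lemma Lp_cong: "(\<And>x. x \<in> space M \<Longrightarrow> f x = g x) \<Longrightarrow> Lp M p f = Lp M p g"
  by (intro antisym Lp_mono) auto

lemma Lp_cmult:
  assumes [measurable]: "f \<in> borel_measurable M" and "1 \<le> p"
  shows "Lp M p (\<lambda>x. c * f x) = c * Lp M p f"
proof (cases "p = \<infinity>")
  case False
  then have "enn2real p \<noteq> 0" using assms by (auto simp: enn2real_eq_0_iff)
  with False show ?thesis
    by (simp add: Lp_finite epow_mult nn_integral_cmult epow_epow)
qed (simp add: Lp_top SUP_mult_left_ennreal)

text \<open>Minkowski for countable sums at once, with no induction or limit. The function
  \<open>h i\<close>, which is \<open>F i\<close> to the power r times \<open>c i\<close> to the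
  power 1 - r, has integral \<open>c i\<close>; the factorisation of \<open>F i\<close> into
  \<open>c i\<close> to the power 1 - 1/r and \<open>h i\<close> to the power 1/r is what Holder's
  inequality over the index needs.\<close>

theorem Lp_suminf_le:
  fixes F :: "nat \<Rightarrow> 'a \<Rightarrow> ennreal"
  assumes [measurable]: "\<And>i. F i \<in> borel_measurable M" and p1: "1 \<le> p"
  shows "Lp M p (\<lambda>x. \<Sum>i. F i x) \<le> (\<Sum>i. Lp M p (F i))"
proof (cases "p = \<infinity>")
  case True
  then show ?thesis
    by (auto simp: Lp_top intro!: SUP_least suminf_le SUP_upper)
next
  case False
  define r where "r = enn2real p"
  have r: "1 \<le> r" using False p1 by (simp add: r_def enn2real_ge_1)
  define c where "c i = Lp M p (F i)" for i
  have c: "epow (c i) r = (\<integral>\<^sup>+x. epow (F i x) r \<partial>M)" for i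
    using epow_Lp[OF False p1, of M "F i"] by (simp add: c_def r_def)
  define h where "h i x = epow (F i x) r * epow (c i) (1 - r)" for i x
  have [measurable]: "h i \<in> borel_measurable M" for i unfolding h_def by simp
  \<comment> \<open>Since \<open>epow 0 (1 - r) = 0\<close>, a summand of norm 0 disappears from
    \<open>h\<close>; the factorisation is therefore valid only where that summand itself
    vanishes.\<close>
  have zero: "AE x in M. \<forall>i. c i = 0 \<longrightarrow> F i x = 0"
  proof (subst AE_all_countable, safe)
    fix i show "AE x in M. c i = 0 \<longrightarrow> F i x = 0"
    proof (cases "c i = 0")
      case True
      then have "(\<integral>\<^sup>+x. epow (F i x) r \<partial>M) = 0" using c[of i] by simp
      then show ?thesis by (simp add: nn_integral_0_iff_AE)
    qed simp
  qed
  \<comment> \<open>Holder's inequality for the counting measure, applied to the normalised functions.\<close>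
  have bound: "epow (\<Sum>i. F i x) r \<le> epow (\<Sum>i. c i) (r - 1) * (\<Sum>i. h i x)"
    if z: "\<forall>i. c i = 0 \<longrightarrow> F i x = 0" for x
  proof -
    have Fle: "F i x \<le> epow (c i) (1 - 1/r) * epow (h i x) (1/r)" for i
    proof -
      have "epow (c i) (1 - 1/r) * epow (h i x) (1/r)
          = F i x * (epow (c i) (1 - 1/r) * epow (c i) ((1 - r) * (1/r)))"
        using r by (simp add: h_def epow_mult epow_epow ac_simps)
      also have "\<dots> = F i x * epow (c i) 0"
        using r by (simp flip: epow_add add: field_simps)
      finally have "\<dots> = epow (c i) (1 - 1/r) * epow (h i x) (1/r)" ..
      moreover have "F i x \<le> F i x * epow (c i) 0"
        using z[rule_format, of i]
        by (cases "c i") (auto simp: epow_ennreal ennreal_mult_top)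
      ultimately show ?thesis by simp
    qed
    have "(\<Sum>i. F i x) \<le> (\<Sum>i. epow (c i) (1 - 1/r) * epow (h i x) (1/r))"
      by (intro suminf_le Fle) auto
    also have "\<dots> \<le> epow (\<Sum>i. c i) (1 - 1/r) * epow (\<Sum>i. h i x) (1/r)"
      using nn_integral_Holder2[of c "count_space UNIV" "\<lambda>i. h i x" "1 - 1/r" "1/r"] r
      by (simp add: nn_integral_count_space_nat)
    finally have "epow (\<Sum>i. F i x) r \<le> epow (epow (\<Sum>i. c i) (1 - 1/r) * epow (\<Sum>i. h i x) (1/r)) r"
      using r by (intro epow_mono) auto
    also have "\<dots> = epow (\<Sum>i. c i) (r - 1) * (\<Sum>i. h i x)"
      using r by (simp add: epow_mult epow_epow algebra_simps)
    finally show ?thesis .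
  qed
  have "(\<integral>\<^sup>+x. epow (\<Sum>i. F i x) r \<partial>M) \<le> (\<integral>\<^sup>+x. epow (\<Sum>i. c i) (r - 1) * (\<Sum>i. h i x) \<partial>M)"
    by (rule nn_integral_mono_AE, use zero in eventually_elim) (rule bound)
  also have "\<dots> = epow (\<Sum>i. c i) (r - 1) * (\<Sum>i. c i)"
    by (simp add: nn_integral_cmult nn_integral_suminf h_def nn_integral_multc flip: c epow_add)
  also have "\<dots> = epow (\<Sum>i. c i) r"
    using epow_add[of "\<Sum>i. c i" "r - 1" 1] by simp
  finally have "epow (\<integral>\<^sup>+x. epow (\<Sum>i. F i x) r \<partial>M) (1/r) \<le> epow (epow (\<Sum>i. c i) r) (1/r)"
    using r by (intro epow_mono) auto
  then show ?thesis
    using False r by (simp add: Lp_finite r_def[symmetric] c_def[symmetric] epow_epow)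
qed

section \<open>Reciprocal exponents and Holder's inequality for conjugate exponents\<close>

lemma inv_exp_eq_0_iff: "1 \<le> p \<Longrightarrow> inv_exp p = 0 \<longleftrightarrow> p = \<infinity>"
  using enn2real_ge_1[of p] by (auto simp: inv_exp_def)

lemma inv_exp_le_1: "1 \<le> p \<Longrightarrow> inv_exp p \<le> 1"
  using enn2real_ge_1[of p] by (auto simp: inv_exp_def)

lemma inv_exp_nonneg: "0 \<le> inv_exp p"
  by (auto simp: inv_exp_def)

lemma Lp_1: "inv_exp p = 1 \<Longrightarrow> Lp M p f = (\<integral>\<^sup>+x. f x \<partial>M)"
  by (auto simp: inv_exp_def Lp_def split: if_splits)

theorem Lp_Holder:
  assumes [measurable]: "f \<in> borel_measurable M" "g \<in> borel_measurable M"
    and "1 \<le> p1" "1 \<le> p2" and conj: "inv_exp p1 + inv_exp p2 = 1"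
  shows "(\<integral>\<^sup>+x. f x * g x \<partial>M) \<le> Lp M p1 f * Lp M p2 g"
proof -
  consider "p1 = \<infinity>" | "p2 = \<infinity>" | "p1 \<noteq> \<infinity>" "p2 \<noteq> \<infinity>" by blast
  then show ?thesis
  proof cases
    case 1
    then have "Lp M p2 g = (\<integral>\<^sup>+x. g x \<partial>M)" using conj by (intro Lp_1) (simp add: inv_exp_def)
    moreover have "(\<integral>\<^sup>+x. f x * g x \<partial>M) \<le> (\<integral>\<^sup>+x. (SUP x\<in>space M. f x) * g x \<partial>M)"
      by (intro nn_integral_mono mult_right_mono SUP_upper) auto
    ultimately show ?thesis using 1 by (simp add: nn_integral_cmult Lp_top)
  next
    case 2
    then have "Lp M p1 f = (\<integral>\<^sup>+x. f x \<partial>M)" using conj by (intro Lp_1) (simp add: inv_exp_def)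
    moreover have "(\<integral>\<^sup>+x. f x * g x \<partial>M) \<le> (\<integral>\<^sup>+x. f x * (SUP x\<in>space M. g x) \<partial>M)"
      by (intro nn_integral_mono mult_left_mono SUP_upper) auto
    ultimately show ?thesis using 2 by (simp add: nn_integral_multc Lp_top)
  next
    case 3
    then have r: "1 \<le> enn2real p1" "1 \<le> enn2real p2" using assms by (auto simp: enn2real_ge_1)
    show ?thesis
      using nn_integral_Holder2[of "\<lambda>x. epow (f x) (enn2real p1)" M "\<lambda>x. epow (g x) (enn2real p2)"
          "1 / enn2real p1" "1 / enn2real p2"] 3 r conj
      by (simp add: inv_exp_def Lp_finite epow_epow)
  qed
qed

section \<open>Young's inequality for kernels\<close>

text \<open>For finite exponents, \<open>K f g\<close> is split as \<open>(K f^r1 g^r2)^(1/r) * (K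
  f^r1)^(1/r1 - 1/r) * (K g^r2)^(1/r2 - 1/r)\<close>, whose outer exponents sum to 1, and Holder is
  applied in (y, z). Marginals over z and y bound the last two factors. Integrating the r-th power
  over x then uses the marginal over x, and the powers of \<open>L\<close> combine to exactly
  \<open>L\<close>. Three unrelated measure spaces are allowed so that the theorem serves triples of
  cells as well as sequences. Positivity and finiteness of \<open>L\<close> give
  \<open>epow L 0 = 1\<close> at infinite exponents.\<close>

theorem Young_kernel:
  fixes K :: "'a \<Rightarrow> 'b \<Rightarrow> 'c \<Rightarrow> ennreal" and L :: ennreal
  assumes sf: "sigma_finite_measure M1" "sigma_finite_measure M2" "sigma_finite_measure M3"
    and K [measurable]: "(\<lambda>(x, y, z). K x y z) \<in> borel_measurable (M1 \<Otimes>\<^sub>M (M2 \<Otimes>\<^sub>M M3))"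
    and K1: "\<And>y z. y \<in> space M2 \<Longrightarrow> z \<in> space M3 \<Longrightarrow> (\<integral>\<^sup>+x. K x y z \<partial>M1) \<le> L"
    and K2: "\<And>x z. x \<in> space M1 \<Longrightarrow> z \<in> space M3 \<Longrightarrow> (\<integral>\<^sup>+y. K x y z \<partial>M2) \<le> L"
    and K3: "\<And>x y. x \<in> space M1 \<Longrightarrow> y \<in> space M2 \<Longrightarrow> (\<integral>\<^sup>+z. K x y z \<partial>M3) \<le> L"
    and L: "0 < L" "L < \<infinity>"
    and f [measurable]: "f \<in> borel_measurable M2" and g [measurable]: "g \<in> borel_measurable M3"
    and exps: "1 \<le> p1" "1 \<le> p2" "1 \<le> p" "inv_exp p = inv_exp p1 + inv_exp p2 - 1"
  shows "Lp M1 p (\<lambda>x. \<integral>\<^sup>+y. \<integral>\<^sup>+z. K x y z * f y * g z \<partial>M3 \<partial>M2) \<le> L * Lp M2 p1 f * Lp M3 p2 g"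
proof -
  interpret M1: sigma_finite_measure M1 by fact
  interpret M2: sigma_finite_measure M2 by fact
  interpret M3: sigma_finite_measure M3 by fact
  interpret M23: pair_sigma_finite M2 M3 ..
  interpret M12: pair_sigma_finite M1 M2 ..
  interpret M13: pair_sigma_finite M1 M3 ..
  have Kx [measurable]: "(\<lambda>(y, z). K x y z) \<in> borel_measurable (M2 \<Otimes>\<^sub>M M3)" if [simp]: "x \<in> space M1" for x
    using measurable_compose[OF measurable_Pair1' K, of x] by simp
  have Kx_xy: "(\<lambda>(x, y). K x y z) \<in> borel_measurable (M1 \<Otimes>\<^sub>M M2)" if [simp]: "z \<in> space M3" for z
  proof -
    have "(\<lambda>q. (fst q, snd q, z)) \<in> measurable (M1 \<Otimes>\<^sub>M M2) (M1 \<Otimes>\<^sub>M (M2 \<Otimes>\<^sub>M M3))" by measurable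
    from measurable_compose[OF this K] show ?thesis by (simp add: case_prod_beta)
  qed
  have Kx_xz: "(\<lambda>(x, z). K x y z) \<in> borel_measurable (M1 \<Otimes>\<^sub>M M3)" if [simp]: "y \<in> space M2" for y
  proof -
    have "(\<lambda>q. (fst q, y, snd q)) \<in> measurable (M1 \<Otimes>\<^sub>M M3) (M1 \<Otimes>\<^sub>M (M2 \<Otimes>\<^sub>M M3))" by measurable
    from measurable_compose[OF this K] show ?thesis by (simp add: case_prod_beta)
  qed
  have Kz: "(\<lambda>z. K x y z) \<in> borel_measurable M3" if "x \<in> space M1" "y \<in> space M2" for x y
    using measurable_compose[OF measurable_Pair1'[OF that(2)] Kx[OF that(1)]] by simp
  have Ky: "(\<lambda>y. K x y z) \<in> borel_measurable M2" if "x \<in> space M1" "z \<in> space M3" for x z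
    using measurable_compose[OF measurable_Pair2'[OF that(2)] Kx[OF that(1)]] by simp
  have Kxx: "(\<lambda>x. K x y z) \<in> borel_measurable M1" if "y \<in> space M2" "z \<in> space M3" for y z
    using measurable_compose[OF measurable_Pair2'[OF that(1)] Kx_xy[OF that(2)]] by simp
  define H where "H x = (\<integral>\<^sup>+y. \<integral>\<^sup>+z. K x y z * f y * g z \<partial>M3 \<partial>M2)" for x
  have H: "H x = (\<integral>\<^sup>+q. K x (fst q) (snd q) * f (fst q) * g (snd q) \<partial>(M2 \<Otimes>\<^sub>M M3))"
    if x: "x \<in> space M1" for x
  proof -
    have "(\<lambda>q. K x (fst q) (snd q)) \<in> borel_measurable (M2 \<Otimes>\<^sub>M M3)"
      using Kx[OF x] by (simp add: case_prod_beta)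
    note [measurable] = this
    show ?thesis unfolding H_def
      by (subst M3.nn_integral_fst[symmetric]) auto
  qed
  have fst_part: "(\<integral>\<^sup>+q. K x (fst q) (snd q) * F (fst q) \<partial>(M2 \<Otimes>\<^sub>M M3)) \<le> L * (\<integral>\<^sup>+y. F y \<partial>M2)"
    if x: "x \<in> space M1" and [measurable]: "F \<in> borel_measurable M2" for x F
  proof -
    have [measurable]: "(\<lambda>q. K x (fst q) (snd q)) \<in> borel_measurable (M2 \<Otimes>\<^sub>M M3)"
      using Kx[OF x] by (simp add: case_prod_beta)
    have "(\<integral>\<^sup>+q. K x (fst q) (snd q) * F (fst q) \<partial>(M2 \<Otimes>\<^sub>M M3)) = (\<integral>\<^sup>+y. \<integral>\<^sup>+z. K x y z * F y \<partial>M3 \<partial>M2)"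
      by (subst M3.nn_integral_fst[symmetric]) auto
    also have "\<dots> \<le> (\<integral>\<^sup>+y. L * F y \<partial>M2)"
      using x by (intro nn_integral_mono) (simp add: nn_integral_multc Kz K3 mult_right_mono)
    finally show ?thesis by (simp add: nn_integral_cmult)
  qed
  have snd_part: "(\<integral>\<^sup>+q. K x (fst q) (snd q) * G (snd q) \<partial>(M2 \<Otimes>\<^sub>M M3)) \<le> L * (\<integral>\<^sup>+z. G z \<partial>M3)"
    if x: "x \<in> space M1" and [measurable]: "G \<in> borel_measurable M3" for x G
  proof -
    have [measurable]: "(\<lambda>q. K x (fst q) (snd q)) \<in> borel_measurable (M2 \<Otimes>\<^sub>M M3)"
      using Kx[OF x] by (simp add: case_prod_beta)
    have "(\<integral>\<^sup>+q. K x (fst q) (snd q) * G (snd q) \<partial>(M2 \<Otimes>\<^sub>M M3)) = (\<integral>\<^sup>+z. \<integral>\<^sup>+y. K x y z * G z \<partial>M2 \<partial>M3)"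
      by (subst M23.nn_integral_snd[symmetric]) (auto simp: case_prod_beta)
    also have "\<dots> \<le> (\<integral>\<^sup>+z. L * G z \<partial>M3)"
      using x by (intro nn_integral_mono) (simp add: nn_integral_multc Ky K2 mult_right_mono)
    finally show ?thesis by (simp add: nn_integral_cmult)
  qed
  show ?thesis
  proof (cases "p = \<infinity>")
    case True
    then have conj: "inv_exp p1 + inv_exp p2 = 1" using exps by (simp add: inv_exp_def)
    have "H x \<le> L * Lp M2 p1 f * Lp M3 p2 g" if x: "x \<in> space M1" for x
    proof -
      \<comment> \<open>Holder's inequality for the measure with density \<open>K x\<close>.\<close>
      have Km [measurable]: "(\<lambda>q. K x (fst q) (snd q)) \<in> borel_measurable (M2 \<Otimes>\<^sub>M M3)"
        using Kx[OF x] by (simp add: case_prod_beta)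
      define Q where "Q = density (M2 \<Otimes>\<^sub>M M3) (\<lambda>q. K x (fst q) (snd q))"
      have [measurable_cong]: "sets Q = sets (M2 \<Otimes>\<^sub>M M3)" by (simp add: Q_def)
      have sp: "space Q = space M2 \<times> space M3" by (simp add: Q_def space_pair_measure)
      have 1: "Lp Q p1 (\<lambda>q. f (fst q)) \<le> epow L (inv_exp p1) * Lp M2 p1 f"
      proof (cases "p1 = \<infinity>")
        case True
        have "epow L 0 = 1" using L by (cases L) (auto simp: epow_ennreal)
        then show ?thesis using True
          by (auto simp: Lp_top sp inv_exp_def intro!: SUP_least SUP_upper)
      next
        case False
        have "(\<integral>\<^sup>+q. epow (f (fst q)) (enn2real p1) \<partial>Q) \<le> L * (\<integral>\<^sup>+y. epow (f y) (enn2real p1) \<partial>M2)"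
          unfolding Q_def using fst_part[OF x, of "\<lambda>y. epow (f y) (enn2real p1)"]
          by (subst nn_integral_density) auto
        from epow_mono[OF this, of "1 / enn2real p1"] False show ?thesis
          by (simp add: Lp_finite inv_exp_def epow_mult)
      qed
      have 2: "Lp Q p2 (\<lambda>q. g (snd q)) \<le> epow L (inv_exp p2) * Lp M3 p2 g"
      proof (cases "p2 = \<infinity>")
        case True
        have "epow L 0 = 1" using L by (cases L) (auto simp: epow_ennreal)
        then show ?thesis using True
          by (auto simp: Lp_top sp inv_exp_def intro!: SUP_least SUP_upper)
      next
        case False
        have "(\<integral>\<^sup>+q. epow (g (snd q)) (enn2real p2) \<partial>Q) \<le> L * (\<integral>\<^sup>+y. epow (g y) (enn2real p2) \<partial>M3)"
          unfolding Q_def using snd_part[OF x, of "\<lambda>y. epow (g y) (enn2real p2)"]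
          by (subst nn_integral_density) auto
        from epow_mono[OF this, of "1 / enn2real p2"] False show ?thesis
          by (simp add: Lp_finite inv_exp_def epow_mult)
      qed
      have "H x = (\<integral>\<^sup>+q. f (fst q) * g (snd q) \<partial>Q)"
        unfolding H[OF x] Q_def by (subst nn_integral_density) (auto simp: mult.assoc)
      also have "\<dots> \<le> Lp Q p1 (\<lambda>q. f (fst q)) * Lp Q p2 (\<lambda>q. g (snd q))"
        by (rule Lp_Holder) (use exps conj in auto)
      also have "\<dots> \<le> (epow L (inv_exp p1) * Lp M2 p1 f) * (epow L (inv_exp p2) * Lp M3 p2 g)"
        by (intro mult_mono 1 2) auto
      also have "\<dots> = epow L (inv_exp p1 + inv_exp p2) * Lp M2 p1 f * Lp M3 p2 g"
        by (simp add: epow_add ac_simps)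
      finally show ?thesis by (simp add: conj)
    qed
    then show ?thesis using True by (auto simp: Lp_top H_def intro!: SUP_least)
  next
    case False
    \<comment> \<open>If one reciprocal were 0, the relation would give
      \<open>inv_exp p <= 0\<close>, hence \<open>p = \<infinity>\<close>.\<close>
    have fin: "p1 \<noteq> \<infinity>" "p2 \<noteq> \<infinity>"
    proof -
      have "0 < inv_exp p" using False exps inv_exp_nonneg[of p] inv_exp_eq_0_iff[of p] by linarith
      then have "0 < inv_exp p1" "0 < inv_exp p2"
        using exps inv_exp_le_1[of p1] inv_exp_le_1[of p2] by linarith+
      then show "p1 \<noteq> \<infinity>" "p2 \<noteq> \<infinity>" by (auto simp: inv_exp_def)
    qed
    define r where "r = enn2real p"
    define r1 where "r1 = enn2real p1"
    define r2 where "r2 = enn2real p2"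
    have r: "1 \<le> r" "1 \<le> r1" "1 \<le> r2"
      using False fin exps by (auto simp: r_def r1_def r2_def enn2real_ge_1)
    have rel: "1 / r = 1 / r1 + 1 / r2 - 1"
      using False fin exps by (simp add: inv_exp_def r_def r1_def r2_def)
    \<comment> \<open>By \<open>rel\<close> the two differences are 1 - 1/r2 and 1 - 1/r1.\<close>
    have ge: "0 \<le> 1 / r1 - 1 / r" "0 \<le> 1 / r2 - 1 / r"
      using rel r by auto
    have nonneg: "0 \<le> 1 / r"
      using r by simp
    have sum1: "1/r + (1/r1 - 1/r) + (1/r2 - 1/r) = 1"
      using rel by simp
    define FF where "FF = (\<integral>\<^sup>+y. epow (f y) r1 \<partial>M2)"
    define GG where "GG = (\<integral>\<^sup>+z. epow (g z) r2 \<partial>M3)"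
    define A where "A x = (\<integral>\<^sup>+y. \<integral>\<^sup>+z. K x y z * epow (f y) r1 * epow (g z) r2 \<partial>M3 \<partial>M2)" for x
    have pointwise: "H x \<le> epow (A x) (1/r) * epow (L * FF) (1/r1 - 1/r) * epow (L * GG) (1/r2 - 1/r)"
      if x: "x \<in> space M1" for x
    proof -
      have Km [measurable]: "(\<lambda>q. K x (fst q) (snd q)) \<in> borel_measurable (M2 \<Otimes>\<^sub>M M3)"
        using Kx[OF x] by (simp add: case_prod_beta)
      have eq: "k * s * t \<le> epow (k * epow s r1 * epow t r2) (1/r) * epow (k * epow s r1) (1/r1 - 1/r)
          * epow (k * epow t r2) (1/r2 - 1/r)" for k s t :: ennreal
      proof -
        have e1: "r1 * (1/r) + r1 * (1/r1 - 1/r) = 1" and e2: "r2 * (1/r) + r2 * (1/r2 - 1/r) = 1"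
          using r by (simp_all add: field_simps)
        have e3: "1/r + (1/r1 - 1/r) + (1/r2 - 1/r) = 1" using rel by simp
        have "epow (k * epow s r1 * epow t r2) (1/r) * epow (k * epow s r1) (1/r1 - 1/r)
          * epow (k * epow t r2) (1/r2 - 1/r)
          = (epow k (1/r) * epow k (1/r1 - 1/r) * epow k (1/r2 - 1/r))
          * (epow s (r1 * (1/r)) * epow s (r1 * (1/r1 - 1/r)))
          * (epow t (r2 * (1/r)) * epow t (r2 * (1/r2 - 1/r)))"
          by (simp only: epow_mult epow_epow ac_simps)
        also have "\<dots> = k * s * t"
          by (simp only: epow_add[symmetric] e1 e2 e3 epow_one_right)
        finally show ?thesis by simp
      qed
      have "H x \<le> (\<integral>\<^sup>+q. epow (K x (fst q) (snd q) * epow (f (fst q)) r1 * epow (g (snd q)) r2) (1/r)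
          * epow (K x (fst q) (snd q) * epow (f (fst q)) r1) (1/r1 - 1/r)
          * epow (K x (fst q) (snd q) * epow (g (snd q)) r2) (1/r2 - 1/r) \<partial>(M2 \<Otimes>\<^sub>M M3))"
        unfolding H[OF x] by (intro nn_integral_mono eq)
      also have "\<dots> \<le> epow (\<integral>\<^sup>+q. K x (fst q) (snd q) * epow (f (fst q)) r1 * epow (g (snd q)) r2 \<partial>(M2 \<Otimes>\<^sub>M M3)) (1/r)
          * epow (\<integral>\<^sup>+q. K x (fst q) (snd q) * epow (f (fst q)) r1 \<partial>(M2 \<Otimes>\<^sub>M M3)) (1/r1 - 1/r)
          * epow (\<integral>\<^sup>+q. K x (fst q) (snd q) * epow (g (snd q)) r2 \<partial>(M2 \<Otimes>\<^sub>M M3)) (1/r2 - 1/r)"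
        by (intro nn_integral_Holder3 ge nonneg sum1) measurable
      also have "\<dots> \<le> epow (A x) (1/r) * epow (L * FF) (1/r1 - 1/r) * epow (L * GG) (1/r2 - 1/r)"
      proof (intro mult_mono epow_mono ge)
        show "(\<integral>\<^sup>+q. K x (fst q) (snd q) * epow (f (fst q)) r1 * epow (g (snd q)) r2 \<partial>(M2 \<Otimes>\<^sub>M M3)) \<le> A x"
          unfolding A_def by (subst M3.nn_integral_fst[symmetric]) auto
      qed (use r x in \<open>auto simp: FF_def GG_def intro!: fst_part snd_part\<close>)
      finally show ?thesis .
    qed
    have K': "(\<lambda>q. K (fst (fst q)) (snd (fst q)) (snd q)) \<in> borel_measurable ((M1 \<Otimes>\<^sub>M M2) \<Otimes>\<^sub>M M3)"
    proof -
      have "(\<lambda>q. (fst (fst q), snd (fst q), snd q)) \<in> measurable ((M1 \<Otimes>\<^sub>M M2) \<Otimes>\<^sub>M M3) (M1 \<Otimes>\<^sub>M (M2 \<Otimes>\<^sub>M M3))"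
        by measurable
      from measurable_compose[OF this K] show ?thesis by (simp add: case_prod_beta)
    qed
    note [measurable] = K'
    have Am2: "(\<lambda>q. \<integral>\<^sup>+z. K (fst q) (snd q) z * epow (f (snd q)) r1 * epow (g z) r2 \<partial>M3)
        \<in> borel_measurable (M1 \<Otimes>\<^sub>M M2)"
      by measurable
    have A_meas [measurable]: "A \<in> borel_measurable M1"
    proof -
      have "(\<lambda>x. \<integral>\<^sup>+y. (\<lambda>q. \<integral>\<^sup>+z. K (fst q) (snd q) z * epow (f (snd q)) r1 * epow (g z) r2 \<partial>M3) (x, y) \<partial>M2)
         \<in> borel_measurable M1"
        by (intro M2.borel_measurable_nn_integral_fst Am2)
      then show ?thesis by (simp add: A_def[abs_def])
    qed
    have "(\<integral>\<^sup>+x. A x \<partial>M1) = (\<integral>\<^sup>+y. \<integral>\<^sup>+x. \<integral>\<^sup>+z. K x y z * epow (f y) r1 * epow (g z) r2 \<partial>M3 \<partial>M1 \<partial>M2)"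
      unfolding A_def using Am2 by (intro M12.Fubini'[symmetric]) (simp add: case_prod_beta)
    also have "\<dots> = (\<integral>\<^sup>+y. \<integral>\<^sup>+z. \<integral>\<^sup>+x. K x y z * epow (f y) r1 * epow (g z) r2 \<partial>M1 \<partial>M3 \<partial>M2)"
    proof (intro nn_integral_cong)
      fix y assume y: "y \<in> space M2"
      have [measurable]: "(\<lambda>q. K (fst q) y (snd q)) \<in> borel_measurable (M1 \<Otimes>\<^sub>M M3)"
        using Kx_xz[OF y] by (simp add: case_prod_beta)
      show "(\<integral>\<^sup>+x. \<integral>\<^sup>+z. K x y z * epow (f y) r1 * epow (g z) r2 \<partial>M3 \<partial>M1)
         = (\<integral>\<^sup>+z. \<integral>\<^sup>+x. K x y z * epow (f y) r1 * epow (g z) r2 \<partial>M1 \<partial>M3)"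
        by (intro M13.Fubini'[symmetric]) (simp add: case_prod_beta)
    qed
    \<comment> \<open>The order of integration was changed to put x innermost, so that the marginal
      bound \<open>K1\<close> applies.\<close>
    also have "\<dots> \<le> (\<integral>\<^sup>+y. \<integral>\<^sup>+z. L * epow (f y) r1 * epow (g z) r2 \<partial>M3 \<partial>M2)"
    proof (intro nn_integral_mono)
      fix y z assume yz: "y \<in> space M2" "z \<in> space M3"
      note [measurable] = Kxx[OF yz]
      show "(\<integral>\<^sup>+x. K x y z * epow (f y) r1 * epow (g z) r2 \<partial>M1) \<le> L * epow (f y) r1 * epow (g z) r2"
        using yz by (simp add: nn_integral_multc K1 mult_right_mono)
    qed
    also have "\<dots> = L * FF * GG"
      by (simp add: nn_integral_cmult nn_integral_multc FF_def GG_def)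
    finally have A_int: "(\<integral>\<^sup>+x. A x \<partial>M1) \<le> L * FF * GG" .
    have "(\<integral>\<^sup>+x. epow (H x) r \<partial>M1)
      \<le> (\<integral>\<^sup>+x. A x * (epow (L * FF) (r * (1/r1 - 1/r)) * epow (L * GG) (r * (1/r2 - 1/r))) \<partial>M1)"
    proof (intro nn_integral_mono)
      fix x assume x: "x \<in> space M1"
      have "epow (H x) r \<le> epow (epow (A x) (1/r) * epow (L * FF) (1/r1 - 1/r) * epow (L * GG) (1/r2 - 1/r)) r"
        using r by (intro epow_mono pointwise x) auto
      also have "\<dots> = epow (A x) (1/r * r) * (epow (L * FF) (r * (1/r1 - 1/r)) * epow (L * GG) (r * (1/r2 - 1/r)))"
        by (simp only: epow_mult epow_epow ac_simps)
      finally show "epow (H x) r \<le> A x * (epow (L * FF) (r * (1/r1 - 1/r)) * epow (L * GG) (r * (1/r2 - 1/r)))"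
        using r by simp
    qed
    also have "\<dots> = (\<integral>\<^sup>+x. A x \<partial>M1) * (epow (L * FF) (r * (1/r1 - 1/r)) * epow (L * GG) (r * (1/r2 - 1/r)))"
      by (simp add: nn_integral_multc)
    also have "\<dots> \<le> (L * FF * GG) * (epow (L * FF) (r * (1/r1 - 1/r)) * epow (L * GG) (r * (1/r2 - 1/r)))"
      by (intro mult_right_mono A_int) auto
    finally have "epow (\<integral>\<^sup>+x. epow (H x) r \<partial>M1) (1/r) \<le>
       epow ((L * FF * GG) * (epow (L * FF) (r * (1/r1 - 1/r)) * epow (L * GG) (r * (1/r2 - 1/r)))) (1/r)"
      using r by (intro epow_mono) auto
    also have "\<dots> = (epow L (1/r) * epow L (r * (1/r1 - 1/r) * (1/r)) * epow L (r * (1/r2 - 1/r) * (1/r)))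
       * (epow FF (1/r) * epow FF (r * (1/r1 - 1/r) * (1/r))) * (epow GG (1/r) * epow GG (r * (1/r2 - 1/r) * (1/r)))"
      by (simp only: epow_mult epow_epow ac_simps)
    also have "\<dots> = L * epow FF (1/r1) * epow GG (1/r2)"
    proof -
      have "r * (1/r1 - 1/r) * (1/r) = 1/r1 - 1/r" "r * (1/r2 - 1/r) * (1/r) = 1/r2 - 1/r"
        using r by auto
      moreover have "1/r + (1/r1 - 1/r) + (1/r2 - 1/r) = 1" "1/r + (1/r1 - 1/r) = 1/r1"
        "1/r + (1/r2 - 1/r) = 1/r2" using rel by simp_all
      ultimately show ?thesis by (simp only: epow_add[symmetric] epow_one_right)
    qed
    finally show ?thesis
      using False fin by (simp add: Lp_finite H_def FF_def GG_def r_def r1_def r2_def)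
  qed
qed

section \<open>Haar measure and cells\<close>

lemma sigma_finite_lebesgue: "sigma_finite_measure (lebesgue :: 'a::euclidean_space measure)"
proof
  from lborel.sigma_finite_countable obtain A :: "'a set set"
    where A: "countable A" "A \<subseteq> sets lborel" "\<Union>A = space lborel" "\<forall>a\<in>A. emeasure lborel a \<noteq> \<infinity>"
    by auto
  then show "\<exists>A::'a set set. countable A \<and> A \<subseteq> sets lebesgue \<and> \<Union>A = space lebesgue
      \<and> (\<forall>a\<in>A. emeasure lebesgue a \<noteq> \<infinity>)"
    by (intro exI[of _ A]) auto
qed

interpretation lebesgue: sigma_finite_measure "lebesgue :: real measure"
  by (rule sigma_finite_lebesgue)

lemma measurable_lebesgue_ident [measurable]: "(\<lambda>x. x) \<in> lebesgue \<rightarrow>\<^sub>M (borel :: 'a::euclidean_space measure)"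
  using id_borel_measurable_lebesgue by (simp add: id_def)

lemma space_bk_measure [simp]: "space (bk_measure \<alpha>) = UNIV"
  by (simp add: bk_measure_def)

lemma sets_bk_measure [simp, measurable_cong]: "sets (bk_measure \<alpha>) = sets lebesgue"
  by (simp add: bk_measure_def)

lemma bk_density_measurable: "(\<lambda>z. ennreal (indicator {0..} z * z powr (2 * \<alpha> + 1))) \<in> borel_measurable lebesgue"
proof -
  have "(\<lambda>z. ennreal (indicator {0..} z * z powr (2 * \<alpha> + 1))) \<in> borel_measurable borel"
    by measurable
  from measurable_compose[OF measurable_lebesgue_ident this] show ?thesis by simp
qed

lemma sigma_finite_bk_measure: "sigma_finite_measure (bk_measure \<alpha>)"
  unfolding bk_measure_def
  using bk_density_measurable by (subst lebesgue.sigma_finite_iff_density_finite) auto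

interpretation bk: sigma_finite_measure "bk_measure \<alpha>" for \<alpha>
  by (rule sigma_finite_bk_measure)

lemma nn_integral_bk_measure:
  assumes "f \<in> borel_measurable lebesgue"
  shows "(\<integral>\<^sup>+z. f z \<partial>bk_measure \<alpha>) = (\<integral>\<^sup>+z. ennreal (indicator {0..} z * z powr (2 * \<alpha> + 1)) * f z \<partial>lebesgue)"
  unfolding bk_measure_def by (intro nn_integral_density bk_density_measurable assms)

text \<open>Lets integrals ignore the exceptional branches of the translation at 0: the density
  vanishes on the negative half-line and a single point is Lebesgue-null.\<close>

lemma AE_bk_measure_pos: "AE x in bk_measure \<alpha>. 0 < x"
proof -
  have "AE x in lebesgue. x \<noteq> (0::real)"
    using AE_lborel_singleton[of "0::real"] by (rule AE_completion)
  then show ?thesis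
    unfolding bk_measure_def using bk_density_measurable
    by (subst AE_density) (auto elim!: eventually_mono simp: indicator_def)
qed

lemma cell_sets [measurable]: "cell n \<in> sets borel" "cell n \<in> sets lebesgue"
  by (auto simp: cell_def)

lemma emeasure_lebesgue_cell: "emeasure lebesgue (cell n) = 1"
  by (simp add: cell_def)

lemma in_cell_iff: "0 \<le> x \<Longrightarrow> x \<in> cell n \<longleftrightarrow> n = nat \<lfloor>x\<rfloor>"
proof -
  assume "0 \<le> x"
  moreover have "x \<in> cell n \<longleftrightarrow> \<lfloor>x\<rfloor> = int n"
    by (simp add: floor_eq_iff cell_def)
  ultimately show ?thesis by auto
qed

lemma cell_meas_eq: "cell_meas \<alpha> n = (\<integral>\<^sup>+z. ennreal (z powr (2 * \<alpha> + 1)) * indicator (cell n) z \<partial>lebesgue)"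
proof -
  have "cell_meas \<alpha> n = (\<integral>\<^sup>+z. ennreal (indicator {0..} z * z powr (2 * \<alpha> + 1)) * indicator (cell n) z \<partial>lebesgue)"
    unfolding cell_meas_def bk_measure_def by (intro emeasure_density bk_density_measurable cell_sets)
  also have "\<dots> = (\<integral>\<^sup>+z. ennreal (z powr (2 * \<alpha> + 1)) * indicator (cell n) z \<partial>lebesgue)"
    by (intro nn_integral_cong) (auto simp: indicator_def cell_def)
  finally show ?thesis .
qed

lemma cell_meas_upper:
  assumes "1/2 \<le> \<alpha>"
  shows "cell_meas \<alpha> n \<le> ennreal ((real n + 1) powr (2 * \<alpha> + 1))"
proof -
  have "cell_meas \<alpha> n \<le> (\<integral>\<^sup>+z. ennreal ((real n + 1) powr (2 * \<alpha> + 1)) * indicator (cell n) z \<partial>lebesgue)"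
    unfolding cell_meas_eq using assms
    by (intro nn_integral_mono) (auto simp: indicator_def cell_def intro!: ennreal_leI powr_mono2)
  also have "\<dots> = ennreal ((real n + 1) powr (2 * \<alpha> + 1))"
    using emeasure_lebesgue_cell by (subst nn_integral_cmult_indicator) auto
  finally show ?thesis .
qed

text \<open>Only the right half of the cell is kept. There z >= n + 1/2 >= (n + 1)/2, also for n =
  0, and the length 1/2 supplies the last factor of
  \<open>2 powr (- 2 * \<alpha> - 2)\<close>.\<close>

lemma cell_meas_lower:
  assumes "1/2 \<le> \<alpha>"
  shows "ennreal (2 powr (- 2 * \<alpha> - 2) * (real n + 1) powr (2 * \<alpha> + 1)) \<le> cell_meas \<alpha> n"
proof -
  have eq: "2 powr (- 2 * \<alpha> - 2) * (real n + 1) powr (2 * \<alpha> + 1) = ((real n + 1) / 2) powr (2 * \<alpha> + 1) * (1/2)"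
    by (simp add: powr_divide powr_minus powr_diff powr_add powr_mult field_simps)
  have "ennreal (2 powr (- 2 * \<alpha> - 2) * (real n + 1) powr (2 * \<alpha> + 1))
     = (\<integral>\<^sup>+z. ennreal (((real n + 1) / 2) powr (2 * \<alpha> + 1)) * indicator {real n + 1/2..<real n + 1} z \<partial>lebesgue)"
    unfolding eq by (subst nn_integral_cmult_indicator) (auto simp: ennreal_mult'' divide_ennreal[symmetric] divide_ennreal_def)
  also have "\<dots> \<le> cell_meas \<alpha> n"
    unfolding cell_meas_eq using assms
    by (intro nn_integral_mono) (auto simp: indicator_def cell_def intro!: ennreal_leI powr_mono2)
  finally show ?thesis .
qed

lemma cell_meas_pos: "1/2 \<le> \<alpha> \<Longrightarrow> 0 < cell_meas \<alpha> n"
  using cell_meas_lower[of \<alpha> n] by (rule less_le_trans[rotated]) simp_all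

lemma cell_meas_finite: "1/2 \<le> \<alpha> \<Longrightarrow> cell_meas \<alpha> n < top"
  using cell_meas_upper[of \<alpha> n] by (rule le_less_trans) simp_all

lemma cell_meas_mult_inverse: "1/2 \<le> \<alpha> \<Longrightarrow> cell_meas \<alpha> n * inverse (cell_meas \<alpha> n) = 1"
  using cell_meas_pos[of \<alpha> n] cell_meas_finite[of \<alpha> n]
  by (simp add: ennreal_divide_self flip: divide_ennreal_def)

text \<open>Restricting the space, instead of cutting off the density by an indicator, makes the
  supremum in \<open>Lp\<close> at exponent \<infinity> range over the cell alone, so that
  \<open>local_norm\<close> is an \<open>Lp\<close> norm for every exponent.\<close>

definition cell_prob :: "real \<Rightarrow> nat \<Rightarrow> real measure" where
  "cell_prob \<alpha> n = scale_measure (inverse (cell_meas \<alpha> n)) (restrict_space (bk_measure \<alpha>) (cell n))"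

definition cell_count :: "real \<Rightarrow> nat measure" where
  "cell_count \<alpha> = density (count_space UNIV) (cell_meas \<alpha>)"

lemma space_cell_prob [simp]: "space (cell_prob \<alpha> n) = cell n"
  by (simp add: cell_prob_def space_scale_measure space_restrict_space)

lemma sets_cell_prob [measurable_cong]: "sets (cell_prob \<alpha> n) = sets (restrict_space lebesgue (cell n))"
  unfolding cell_prob_def sets_scale_measure by (rule sets_restrict_space_cong) simp

lemma measurable_cell_prob_ident: "(\<lambda>x. x) \<in> cell_prob \<alpha> n \<rightarrow>\<^sub>M lebesgue"
  unfolding measurable_cong_sets[OF sets_cell_prob refl]
  by (rule measurable_restrict_space1[OF measurable_ident_sets[OF refl]])

lemma measurable_cell_prob: "f \<in> lebesgue \<rightarrow>\<^sub>M N \<Longrightarrow> f \<in> cell_prob \<alpha> n \<rightarrow>\<^sub>M N"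
  by (rule measurable_compose[OF measurable_cell_prob_ident])

lemma nn_integral_cell_prob:
  assumes "f \<in> borel_measurable (cell_prob \<alpha> n)"
  shows "(\<integral>\<^sup>+x. f x \<partial>cell_prob \<alpha> n) = inverse (cell_meas \<alpha> n) * (\<integral>\<^sup>+x. f x * indicator (cell n) x \<partial>bk_measure \<alpha>)"
proof -
  have "f \<in> borel_measurable (restrict_space (bk_measure \<alpha>) (cell n))"
    using assms unfolding cell_prob_def
    by (subst (asm) measurable_cong_sets[OF sets_scale_measure refl])
  then have "(\<integral>\<^sup>+x. f x \<partial>cell_prob \<alpha> n) =
      inverse (cell_meas \<alpha> n) * (\<integral>\<^sup>+x. f x \<partial>restrict_space (bk_measure \<alpha>) (cell n))"
    unfolding cell_prob_def by (rule nn_integral_scale_measure)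
  then show ?thesis by (simp add: nn_integral_restrict_space)
qed

lemma sigma_finite_cell_prob: "1/2 \<le> \<alpha> \<Longrightarrow> sigma_finite_measure (cell_prob \<alpha> n)"
proof -
  assume a: "1/2 \<le> \<alpha>"
  have "emeasure (cell_prob \<alpha> n) (cell n) = inverse (cell_meas \<alpha> n) * cell_meas \<alpha> n"
    by (simp add: cell_prob_def emeasure_restrict_space cell_meas_def)
  then have "emeasure (cell_prob \<alpha> n) (space (cell_prob \<alpha> n)) = 1"
    using cell_meas_mult_inverse[OF a, of n] by (simp add: mult.commute)
  then interpret finite_measure "cell_prob \<alpha> n" by (intro finite_measureI) simp
  show ?thesis by unfold_locales
qed

lemma AE_cell_prob_pos: "AE x in cell_prob \<alpha> n. 0 < x"
proof -
  have "AE x in restrict_space (bk_measure \<alpha>) (cell n). 0 < x"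
    using AE_bk_measure_pos[of \<alpha>] by (subst AE_restrict_space_iff) (auto elim!: eventually_mono)
  then obtain N where N: "N \<in> null_sets (restrict_space (bk_measure \<alpha>) (cell n))"
    "{x \<in> space (restrict_space (bk_measure \<alpha>) (cell n)). \<not> 0 < x} \<subseteq> N"
    unfolding eventually_ae_filter by auto
  then have "N \<in> null_sets (cell_prob \<alpha> n)"
    by (auto simp: null_sets_def cell_prob_def)
  then show ?thesis
    using N(2) by (intro AE_I'[of N]) (auto simp: space_restrict_space)
qed

lemma nn_integral_bk_measure_cells:
  assumes a: "1/2 \<le> \<alpha>" and [measurable]: "f \<in> borel_measurable lebesgue"
  shows "(\<integral>\<^sup>+x. f x \<partial>bk_measure \<alpha>) = (\<Sum>n. cell_meas \<alpha> n * (\<integral>\<^sup>+x. f x \<partial>cell_prob \<alpha> n))"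
proof -
  have sum_ind: "(\<Sum>n. f x * indicator (cell n) x) = f x" if "0 < x" for x
  proof -
    have "(\<Sum>n. f x * indicator (cell n) x) = (\<Sum>n. if n = nat \<lfloor>x\<rfloor> then f x else 0)"
      using that by (intro suminf_cong) (auto simp: in_cell_iff indicator_def)
    also have "\<dots> = f x"
      by (subst suminf_finite[of "{nat \<lfloor>x\<rfloor>}"]) auto
    finally show ?thesis .
  qed
  have "(\<integral>\<^sup>+x. f x \<partial>bk_measure \<alpha>) = (\<integral>\<^sup>+x. (\<Sum>n. f x * indicator (cell n) x) \<partial>bk_measure \<alpha>)"
    by (rule nn_integral_cong_AE, use AE_bk_measure_pos in eventually_elim) (simp only: sum_ind)
  also have "\<dots> = (\<Sum>n. (\<integral>\<^sup>+x. f x * indicator (cell n) x \<partial>bk_measure \<alpha>))"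
    by (intro nn_integral_suminf) measurable
  also have "\<dots> = (\<Sum>n. cell_meas \<alpha> n * (\<integral>\<^sup>+x. f x \<partial>cell_prob \<alpha> n))"
    by (intro suminf_cong, subst nn_integral_cell_prob)
       (simp_all add: measurable_cell_prob cell_meas_mult_inverse[OF a] flip: mult.assoc)
  finally show ?thesis .
qed

lemma space_cell_count [simp]: "space (cell_count \<alpha>) = UNIV"
  by (simp add: cell_count_def)

lemma sets_cell_count [measurable_cong]: "sets (cell_count \<alpha>) = sets (count_space UNIV)"
  by (simp add: cell_count_def)

lemma nn_integral_cell_count: "(\<integral>\<^sup>+n. f n \<partial>cell_count \<alpha>) = (\<Sum>n. cell_meas \<alpha> n * f n)"
  unfolding cell_count_def by (subst nn_integral_density) (auto simp: nn_integral_count_space_nat)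

lemma sigma_finite_cell_count:
  assumes "1/2 \<le> \<alpha>"
  shows "sigma_finite_measure (cell_count \<alpha>)"
proof -
  interpret sigma_finite_measure "count_space (UNIV :: nat set)"
    by (rule sigma_finite_measure_count_space_countable) simp
  show ?thesis
    unfolding cell_count_def using cell_meas_finite[OF assms]
    by (subst sigma_finite_iff_density_finite) (auto simp: less_top)
qed

section \<open>Amalgam norms as iterated \<open>Lp\<close> norms\<close>

lemma local_norm_eq_Lp:
  assumes [measurable]: "f \<in> borel_measurable lebesgue"
  shows "local_norm \<alpha> p f n = Lp (cell_prob \<alpha> n) p (\<lambda>x. ennreal (norm (f x)))"
proof (cases "p = \<infinity>")
  case True
  then show ?thesis by (simp add: local_norm_def Lp_top)
next
  case False
  have "(\<integral>\<^sup>+x. ennreal (norm (f x) powr enn2real p) \<partial>cell_prob \<alpha> n)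
     = inverse (cell_meas \<alpha> n) * (\<integral>\<^sup>+x. ennreal (norm (f x) powr enn2real p) * indicator (cell n) x \<partial>bk_measure \<alpha>)"
    by (intro nn_integral_cell_prob measurable_cell_prob) measurable
  with False show ?thesis
    by (simp add: local_norm_def Lp_finite epow_ennreal divide_ennreal_def mult.commute)
qed

lemma amalgam_norm_eq_Lp:
  assumes "f \<in> borel_measurable lebesgue"
  shows "amalgam_norm \<alpha> p q f =
    Lp (cell_count \<alpha>) q (\<lambda>n. Lp (cell_prob \<alpha> n) p (\<lambda>x. ennreal (norm (f x))))"
  unfolding amalgam_norm_def Lp_def[of "cell_count \<alpha>"] nn_integral_cell_count local_norm_eq_Lp[OF assms]
    space_cell_count ..

section \<open>Kernel estimates\<close>

text \<open>The indicator is the triangle condition on three side lengths. Including it gives a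
  function symmetric in all three nonnegative arguments, so one marginal estimate yields all
  three.\<close>

definition tri_kernel :: "real \<Rightarrow> real \<Rightarrow> real \<Rightarrow> real \<Rightarrow> real" where
  "tri_kernel \<alpha> x y z = indicator {\<bar>x - y\<bar>..x + y} z * bk_kernel \<alpha> x y z"

definition tri_weight :: "real \<Rightarrow> real \<Rightarrow> real \<Rightarrow> real \<Rightarrow> real" where
  "tri_weight \<alpha> x y z =
     (if x \<le> y + z \<and> y \<le> x + z \<and> z \<le> x + y then max x (max y z) powr (1 - 2 * \<alpha>) / (x * y * z) else 0)"

lemma tri_kernel_measurable [measurable]:
  "(\<lambda>q. tri_kernel \<alpha> (fst q) (fst (snd q)) (snd (snd q))) \<in> borel_measurable (borel \<Otimes>\<^sub>M (borel \<Otimes>\<^sub>M borel))"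
proof -
  have "(\<lambda>q. if \<bar>fst q - fst (snd q)\<bar> \<le> snd (snd q) \<and> snd (snd q) \<le> fst q + fst (snd q)
      then bk_kernel \<alpha> (fst q) (fst (snd q)) (snd (snd q)) else 0) \<in> borel_measurable (borel \<Otimes>\<^sub>M (borel \<Otimes>\<^sub>M borel))"
    unfolding bk_kernel_def by measurable
  then show ?thesis
    by (rule measurable_cong[THEN iffD1, rotated]) (auto simp: tri_kernel_def indicator_def)
qed

lemma C_Gamma_pos: "1/2 \<le> \<alpha> \<Longrightarrow> 0 < C_Gamma \<alpha>"
  unfolding C_Gamma_def by (intro divide_pos_pos mult_pos_pos Gamma_real_pos) auto

lemma tri_kernel_nonneg: "1/2 \<le> \<alpha> \<Longrightarrow> 0 \<le> tri_kernel \<alpha> x y z"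
  using C_Gamma_pos[of \<alpha>] by (simp add: tri_kernel_def bk_kernel_def)

text \<open>The denominator is \<open>0 powr (2 * \<alpha>) = 0\<close>, and division by zero yields
  0.\<close>

lemma tri_kernel_zero: "x = 0 \<or> y = 0 \<or> z = 0 \<Longrightarrow> tri_kernel \<alpha> x y z = 0"
  by (auto simp: tri_kernel_def bk_kernel_def)

lemma tri_kernel_swap12: "tri_kernel \<alpha> x y z = tri_kernel \<alpha> y x z"
  unfolding tri_kernel_def bk_kernel_def
  by (simp add: add.commute mult.commute abs_minus_commute power2_commute[of x y])

lemma tri_kernel_swap23:
  assumes "0 \<le> x" "0 \<le> y" "0 \<le> z"
  shows "tri_kernel \<alpha> x y z = tri_kernel \<alpha> x z y"
proof -
  have "(z\<^sup>2 - (x - y)\<^sup>2) * ((x + y)\<^sup>2 - z\<^sup>2) = (y\<^sup>2 - (x - z)\<^sup>2) * ((x + z)\<^sup>2 - y\<^sup>2)"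
    by (simp add: algebra_simps power2_eq_square)
  moreover have "z \<in> {\<bar>x - y\<bar>..x + y} \<longleftrightarrow> y \<in> {\<bar>x - z\<bar>..x + z}"
    using assms by auto
  ultimately show ?thesis
    unfolding tri_kernel_def bk_kernel_def by (simp add: ac_simps indicator_def)
qed

text \<open>Heron: the bracket in the kernel is \<open>(4 area)\<^sup>2\<close>, and the area is at most half the product of any
  two sides, in particular of the two shorter ones.\<close>

lemma heron_bound:
  fixes x y z :: real
  shows "(z\<^sup>2 - (x - y)\<^sup>2) * ((x + y)\<^sup>2 - z\<^sup>2) \<le> (2 * x * y)\<^sup>2"
proof -
  have "(2 * x * y)\<^sup>2 - (z\<^sup>2 - (x - y)\<^sup>2) * ((x + y)\<^sup>2 - z\<^sup>2) = (z\<^sup>2 - x\<^sup>2 - y\<^sup>2)\<^sup>2"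
    by (simp add: algebra_simps power2_eq_square)
  then show ?thesis by (metis diff_ge_0_iff_ge zero_le_power2)
qed

text \<open>With \<open>m\<close> the longest side, the two shorter ones have product
  \<open>P / m\<close>, so Heron's bound reads \<open>B <= (2 * P / m)^2\<close>. The power
  \<open>\<alpha> - 1/2\<close> keeps the order, and
  \<open>P powr (2 * \<alpha> - 1) / P powr (2 * \<alpha>)\<close> leaves the factor
  \<open>1 / P\<close> of the weight.\<close>

lemma tri_kernel_le:
  assumes a: "1/2 \<le> \<alpha>" and pos: "0 < x" "0 < y" "0 < z"
  shows "tri_kernel \<alpha> x y z \<le> C_Gamma \<alpha> * 2 powr (2 * \<alpha> - 1) * tri_weight \<alpha> x y z"
proof (cases "z \<in> {\<bar>x - y\<bar>..x + y}")
  case False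
  then have "tri_kernel \<alpha> x y z = 0" by (simp add: tri_kernel_def)
  moreover have "0 \<le> tri_weight \<alpha> x y z" using pos by (simp add: tri_weight_def)
  ultimately show ?thesis using C_Gamma_pos[OF a] by simp
next
  case True
  define m where "m = max x (max y z)"
  define B where "B = (z\<^sup>2 - (x - y)\<^sup>2) * ((x + y)\<^sup>2 - z\<^sup>2)"
  have m: "0 < m" using pos by (simp add: m_def)
  have tri: "x \<le> y + z" "y \<le> x + z" "z \<le> x + y" using True by auto
  have B0: "0 \<le> B"
  proof -
    have "(x - y)\<^sup>2 \<le> z\<^sup>2" using tri pos by (intro power2_le_iff_abs_le[THEN iffD2]) auto
    moreover have "z\<^sup>2 \<le> (x + y)\<^sup>2" using tri pos by (intro power_mono) auto
    ultimately show ?thesis by (simp add: B_def)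
  qed
  have B: "B \<le> (2 * (x * y * z / m))\<^sup>2"
  proof -
    have "x * y * z / m \<in> {y * z, x * z, x * y}"
      using pos by (auto simp: m_def max_def)
    moreover have "B \<le> (2 * (x * y))\<^sup>2"
      using heron_bound[of z x y] by (simp add: B_def algebra_simps power2_eq_square)
    moreover have "B \<le> (2 * (x * z))\<^sup>2"
      using heron_bound[of y x z] by (simp add: B_def algebra_simps power2_eq_square)
    moreover have "B \<le> (2 * (y * z))\<^sup>2"
      using heron_bound[of x y z] by (simp add: B_def algebra_simps power2_eq_square)
    ultimately show ?thesis by (elim insertE emptyE) (simp_all only:)
  qed
  define P where "P = x * y * z"
  have P: "0 < P" using pos by (simp add: P_def)
  have "B powr (\<alpha> - 1/2) \<le> ((2 * (P / m))\<^sup>2) powr (\<alpha> - 1/2)"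
    using a B0 B by (intro powr_mono2) (auto simp: P_def)
  also have "\<dots> = (2 * (P / m)) powr (2 * \<alpha> - 1)"
    using P m by (simp add: powr_powr algebra_simps flip: powr_numeral)
  also have "\<dots> = 2 powr (2 * \<alpha> - 1) * (P powr (2 * \<alpha> - 1) * m powr (1 - 2 * \<alpha>))"
    using P m by (simp add: powr_mult powr_divide powr_diff field_simps)
  finally have "C_Gamma \<alpha> * B powr (\<alpha> - 1/2) / P powr (2 * \<alpha>)
      \<le> C_Gamma \<alpha> * (2 powr (2 * \<alpha> - 1) * (P powr (2 * \<alpha> - 1) * m powr (1 - 2 * \<alpha>))) / P powr (2 * \<alpha>)"
    using C_Gamma_pos[OF a] by (intro divide_right_mono mult_left_mono) auto
  also have "\<dots> = C_Gamma \<alpha> * 2 powr (2 * \<alpha> - 1) * (m powr (1 - 2 * \<alpha>) / P)"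
    using P by (simp add: powr_diff field_simps)
  finally show ?thesis
    using True tri by (simp add: tri_kernel_def bk_kernel_def tri_weight_def B_def P_def m_def)
qed

text \<open>The shift by one is exactly what integrality provides: k <= x <= y + z < m + n + 2 gives
  k + 1 <= (m + 1) + (n + 1), and likewise for the other two sides.\<close>

lemma tri_kernel_outside:
  assumes "x \<in> cell k" "y \<in> cell m" "z \<in> cell n"
    and "tri_weight \<alpha> (real k + 1) (real m + 1) (real n + 1) = 0"
  shows "tri_kernel \<alpha> x y z = 0"
proof (rule ccontr)
  assume "tri_kernel \<alpha> x y z \<noteq> 0"
  then have "\<bar>x - y\<bar> \<le> z" "z \<le> x + y" by (auto simp: tri_kernel_def indicator_def split: if_splits)
  with assms(1-3) have "real k < real m + real n + 2" "real m < real k + real n + 2" "real n < real k + real m + 2"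
    by (auto simp: cell_def)
  then have "k \<le> m + n + 1" "m \<le> k + n + 1" "n \<le> k + m + 1" by linarith+
  then have "real k + 1 \<le> (real m + 1) + (real n + 1)" "real m + 1 \<le> (real k + 1) + (real n + 1)"
    "real n + 1 \<le> (real k + 1) + (real m + 1)" by linarith+
  then have "0 < tri_weight \<alpha> (real k + 1) (real m + 1) (real n + 1)"
    by (auto simp: tri_weight_def max_def intro!: divide_pos_pos)
  then show False using assms(4) by simp
qed

lemma tri_weight_nonneg: "0 \<le> tri_weight \<alpha> (real k + 1) (real m + 1) (real n + 1)"
  by (simp add: tri_weight_def)

lemma tri_weight_swap12: "tri_weight \<alpha> x y z = tri_weight \<alpha> y x z"
  by (auto simp: tri_weight_def ac_simps max.left_commute)

lemma tri_weight_swap23: "tri_weight \<alpha> x y z = tri_weight \<alpha> x z y"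
  by (auto simp: tri_weight_def ac_simps max.commute)

text \<open>As \<open>1 - 2 * \<alpha> <= 0\<close>, the maximum may be replaced by
  \<open>z\<close>; the powers of \<open>z\<close> then combine to \<open>z^2\<close>.\<close>

lemma tri_weight_mult_powr_le:
  assumes "1/2 \<le> \<alpha>" "0 < x" "0 < y" "0 < z"
  shows "z powr (2 * \<alpha> + 1) * tri_weight \<alpha> x y z \<le> z / (x * y)"
proof (cases "x \<le> y + z \<and> y \<le> x + z \<and> z \<le> x + y")
  case True
  have "max x (max y z) powr (1 - 2 * \<alpha>) \<le> z powr (1 - 2 * \<alpha>)"
    using assms by (intro powr_mono2') auto
  then have "z powr (2 * \<alpha> + 1) * (max x (max y z) powr (1 - 2 * \<alpha>) / (x * y * z))
     \<le> z powr (2 * \<alpha> + 1) * (z powr (1 - 2 * \<alpha>) / (x * y * z))"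
    using assms by (intro mult_left_mono divide_right_mono) auto
  also have "\<dots> = z powr (2 * \<alpha> + 1 + (1 - 2 * \<alpha>)) / (x * y * z)"
    by (simp only: powr_add times_divide_eq_right)
  also have "\<dots> = z / (x * y)"
    using assms by (simp add: power2_eq_square powr_add)
  finally show ?thesis using True by (simp add: tri_weight_def)
qed (use assms in \<open>auto simp: tri_weight_def\<close>)

text \<open>Uniform in x and y, also near 0 where the kernel is unbounded. The integrand is at most
  \<open>A * (x + y) / (x * y)\<close> on an interval of length 2 min(x, y), and x + y <= 2 max(x,
  y) produces the constant 4. This crude bound replaces the exact total mass 1, which would require
  a Beta integral.\<close>

lemma tri_kernel_mass_le:
  assumes a: "1/2 \<le> \<alpha>" and xy: "0 < x" "0 < y"
  shows "(\<integral>\<^sup>+z. ennreal (tri_kernel \<alpha> x y z * z powr (2 * \<alpha> + 1)) * indicator (cell n) z \<partial>lebesgue)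
    \<le> ennreal (4 * (C_Gamma \<alpha> * 2 powr (2 * \<alpha> - 1)))"
proof -
  define A where "A = C_Gamma \<alpha> * 2 powr (2 * \<alpha> - 1)"
  have A: "0 < A" using C_Gamma_pos[OF a] by (simp add: A_def)
  define b where "b = A * ((x + y) / (x * y))"
  have b: "0 \<le> b" using A xy by (simp add: b_def)
  have le: "tri_kernel \<alpha> x y z * z powr (2 * \<alpha> + 1) \<le> b" if z: "z \<in> {\<bar>x - y\<bar>..x + y}" for z
  proof (cases "z = 0")
    case True
    then show ?thesis using b by simp
  next
    case False
    then have z0: "0 < z" using z by auto
    have "tri_kernel \<alpha> x y z * z powr (2 * \<alpha> + 1) \<le> A * tri_weight \<alpha> x y z * z powr (2 * \<alpha> + 1)"
      unfolding A_def using tri_kernel_le[OF a xy z0] by (intro mult_right_mono) auto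
    also have "\<dots> = A * (z powr (2 * \<alpha> + 1) * tri_weight \<alpha> x y z)" by simp
    also have "\<dots> \<le> A * (z / (x * y))"
      using A by (intro mult_left_mono tri_weight_mult_powr_le[OF a xy z0]) auto
    also have "\<dots> \<le> b" unfolding b_def using A xy z by (intro mult_left_mono divide_right_mono) auto
    finally show ?thesis .
  qed
  have "(\<integral>\<^sup>+z. ennreal (tri_kernel \<alpha> x y z * z powr (2 * \<alpha> + 1)) * indicator (cell n) z \<partial>lebesgue)
     \<le> (\<integral>\<^sup>+z. ennreal b * indicator {\<bar>x - y\<bar>..x + y} z \<partial>lebesgue)"
  proof (intro nn_integral_mono)
    fix z
    show "ennreal (tri_kernel \<alpha> x y z * z powr (2 * \<alpha> + 1)) * indicator (cell n) z
      \<le> ennreal b * indicator {\<bar>x - y\<bar>..x + y} z"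
      using le[of z] by (cases "z \<in> {\<bar>x - y\<bar>..x + y}")
        (auto simp: indicator_def tri_kernel_def intro!: ennreal_leI)
  qed
  also have "\<dots> = ennreal b * ennreal (x + y - \<bar>x - y\<bar>)"
    using xy by (subst nn_integral_cmult_indicator) auto
  also have "\<dots> = ennreal (b * (x + y - \<bar>x - y\<bar>))"
    using b xy by (intro ennreal_mult[symmetric]) auto
  also have "\<dots> \<le> ennreal (4 * A)"
  proof (rule ennreal_leI)
    have "(x + y) * (x + y - \<bar>x - y\<bar>) \<le> 4 * (x * y)"
    proof (cases "x \<le> y")
      case True
      then have "(x + y) * (x + y - \<bar>x - y\<bar>) = (x + y) * (2 * x)" by simp
      also have "\<dots> \<le> (2 * y) * (2 * x)" using True xy by (intro mult_right_mono) auto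
      finally show ?thesis by (simp add: ac_simps)
    next
      case False
      then have "(x + y) * (x + y - \<bar>x - y\<bar>) = (x + y) * (2 * y)" by simp
      also have "\<dots> \<le> (2 * x) * (2 * y)" using False xy by (intro mult_right_mono) auto
      finally show ?thesis by (simp add: ac_simps)
    qed
    then have "(x + y) * (x + y - \<bar>x - y\<bar>) / (x * y) \<le> 4"
      using xy by (simp add: divide_le_eq)
    then have "A * ((x + y) * (x + y - \<bar>x - y\<bar>) / (x * y)) \<le> A * 4"
      using A by (intro mult_left_mono) auto
    then show "b * (x + y - \<bar>x - y\<bar>) \<le> 4 * A"
      by (simp add: b_def mult.commute mult.left_commute)
  qed
  finally show ?thesis by (simp add: A_def)
qed

text \<open>A side of length 1 forces y <= 1 + z <= 2z, so the maximum is at most 2z and the product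
  of the sides at most 2z * z. The weight is thus large enough to absorb the plain mass bound when a
  point lies in the first cell.\<close>

lemma tri_weight_unit_ge:
  assumes a: "1/2 \<le> \<alpha>" and yz: "1 \<le> y" "1 \<le> z" and nz: "tri_weight \<alpha> 1 y z \<noteq> 0"
  shows "2 powr (- 2 * \<alpha>) * z powr (- 2 * \<alpha> - 1) \<le> tri_weight \<alpha> 1 y z"
proof -
  from nz have tri: "1 \<le> y + z" "y \<le> 1 + z" "z \<le> 1 + y" by (auto simp: tri_weight_def split: if_splits)
  have "2 powr (- 2 * \<alpha>) * z powr (- 2 * \<alpha> - 1) = (2 * z) powr (1 - 2 * \<alpha>) / (2 * z * z)"
    using yz by (simp add: powr_mult powr_diff powr_minus power2_eq_square field_simps)
  also have "\<dots> \<le> max 1 (max y z) powr (1 - 2 * \<alpha>) / (y * z)"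
    using yz tri a by (intro frac_le powr_mono2' mult_right_mono mult_pos_pos) auto
  finally show ?thesis using tri by (simp add: tri_weight_def)
qed

text \<open>In the first summand, \<open>2 powr (4 * \<alpha> + 4)\<close> collects
  \<open>2 powr (2 * \<alpha> + 2)\<close> from the inverse cell mass, 4 from the kernel mass, and
  \<open>2 powr (2 * \<alpha>)\<close> from the lower bound on the weight. The second summand serves
  only the value of the convolution at 0.\<close>

definition tri_const :: "real \<Rightarrow> real" where
  "tri_const \<alpha> = C_Gamma \<alpha> * 2 powr (2 * \<alpha> - 1) * 2 powr (4 * \<alpha> + 4) + 2 powr (2 * \<alpha> + 2)"

lemma tri_const_pos: "1/2 \<le> \<alpha> \<Longrightarrow> 0 < tri_const \<alpha>"
  unfolding tri_const_def using C_Gamma_pos[of \<alpha>] by (intro add_nonneg_pos) auto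

lemma inverse_cell_meas_le:
  assumes a: "1/2 \<le> \<alpha>"
  shows "inverse (cell_meas \<alpha> n) \<le> ennreal (2 powr (2 * \<alpha> + 2) * (real n + 1) powr (- 2 * \<alpha> - 1))"
proof -
  define w where "w = 2 powr (- 2 * \<alpha> - 2) * (real n + 1) powr (2 * \<alpha> + 1)"
  have w: "0 < w" by (simp add: w_def)
  obtain c where c: "cell_meas \<alpha> n = ennreal c" "0 \<le> c"
    using cell_meas_finite[OF a, of n] by (auto simp: less_top_ennreal)
  have "w \<le> c" using cell_meas_lower[OF a, of n] c by (simp add: w_def)
  then have "inverse (cell_meas \<alpha> n) \<le> ennreal (inverse w)"
    using w c by (auto simp: inverse_ennreal intro!: ennreal_leI)
  also have "inverse w = 2 powr (2 * \<alpha> + 2) * (real n + 1) powr (- 2 * \<alpha> - 1)"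
  proof -
    have e: "- (- 2 * \<alpha> - 2) = 2 * \<alpha> + 2" "- (2 * \<alpha> + 1) = - 2 * \<alpha> - 1" by simp_all
    show ?thesis
      using powr_minus[of 2 "- 2 * \<alpha> - 2"] powr_minus[of "real n + 1" "2 * \<alpha> + 1"] unfolding e w_def
      by (simp only: inverse_mult_distrib)
  qed
  finally show ?thesis .
qed

text \<open>The central estimate. If \<open>x\<close> or \<open>y\<close> lies in the first cell,
  the kernel admits no pointwise bound, but its mass is at most \<open>4 * A\<close> and the weight
  is bounded below. If both lie beyond it, they are comparable to \<open>X\<close> and
  \<open>Y\<close>, and the kernel times the Haar density is bounded pointwise on the cell of
  \<open>z\<close>. The remaining case has integral 0.\<close>

lemma tri_kernel_cell_integral_le:
  assumes a: "1/2 \<le> \<alpha>" and x: "x \<in> cell k" and y: "y \<in> cell m"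
  shows "(\<integral>\<^sup>+z. ennreal (tri_kernel \<alpha> x y z) \<partial>cell_prob \<alpha> n)
     \<le> ennreal (tri_const \<alpha> * tri_weight \<alpha> (real k + 1) (real m + 1) (real n + 1))"
proof -
  define A where "A = C_Gamma \<alpha> * 2 powr (2 * \<alpha> - 1)"
  have A: "0 < A" using C_Gamma_pos[OF a] by (simp add: A_def)
  define X Y Z where XYZ: "X = real k + 1" "Y = real m + 1" "Z = real n + 1"
  have XYZ1: "1 \<le> X" "1 \<le> Y" "1 \<le> Z" by (auto simp: XYZ)
  define W where "W = tri_weight \<alpha> X Y Z"
  have W0: "0 \<le> W" unfolding W_def XYZ by (rule tri_weight_nonneg)
  have kc: "A * 2 powr (4 * \<alpha> + 4) \<le> tri_const \<alpha>" by (simp add: tri_const_def A_def)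
  have km [measurable]: "(\<lambda>z. ennreal (tri_kernel \<alpha> x y z)) \<in> borel_measurable lebesgue"
  proof -
    have "(\<lambda>z. ennreal (tri_kernel \<alpha> x y z)) \<in> borel_measurable borel"
      using measurable_compose[of "\<lambda>z. (x, y, z)" borel _ _ borel, OF _ tri_kernel_measurable] by simp
    from measurable_compose[OF measurable_lebesgue_ident this] show ?thesis by simp
  qed
  define J where "J = (\<integral>\<^sup>+z. ennreal (tri_kernel \<alpha> x y z * z powr (2 * \<alpha> + 1)) * indicator (cell n) z \<partial>lebesgue)"
  have int: "(\<integral>\<^sup>+z. ennreal (tri_kernel \<alpha> x y z) \<partial>cell_prob \<alpha> n) = inverse (cell_meas \<alpha> n) * J"
  proof -
    have "(\<integral>\<^sup>+z. ennreal (tri_kernel \<alpha> x y z) \<partial>cell_prob \<alpha> n)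
       = inverse (cell_meas \<alpha> n) * (\<integral>\<^sup>+z. ennreal (tri_kernel \<alpha> x y z) * indicator (cell n) z \<partial>bk_measure \<alpha>)"
      by (intro nn_integral_cell_prob measurable_cell_prob km)
    also have "(\<integral>\<^sup>+z. ennreal (tri_kernel \<alpha> x y z) * indicator (cell n) z \<partial>bk_measure \<alpha>) = J"
      unfolding J_def
      by (subst nn_integral_bk_measure, measurable, intro nn_integral_cong)
         (auto simp: indicator_def cell_def tri_kernel_nonneg[OF a] mult.commute simp flip: ennreal_mult)
    finally show ?thesis .
  qed
  \<comment> \<open>It suffices to bound the unnormalised integral, since \<open>cell_meas \<alpha> n\<close> is comparable to \<open>Z powr (2 * \<alpha> + 1)\<close>.\<close>
  have reduce: ?thesis if J: "J \<le> ennreal B" and B: "0 \<le> B"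
      "2 powr (2 * \<alpha> + 2) * Z powr (- 2 * \<alpha> - 1) * B \<le> A * 2 powr (4 * \<alpha> + 4) * W" for B
  proof -
    have "inverse (cell_meas \<alpha> n) * J \<le> ennreal (2 powr (2 * \<alpha> + 2) * Z powr (- 2 * \<alpha> - 1)) * ennreal B"
      using inverse_cell_meas_le[OF a, of n] J by (intro mult_mono) (auto simp: XYZ)
    also have "\<dots> = ennreal (2 powr (2 * \<alpha> + 2) * Z powr (- 2 * \<alpha> - 1) * B)"
      using B by (intro ennreal_mult[symmetric]) auto
    also have "\<dots> \<le> ennreal (tri_const \<alpha> * W)"
      using B(2) mult_right_mono[OF kc W0] by (intro ennreal_leI) linarith
    finally show ?thesis by (simp add: int W_def XYZ)
  qed
  consider "W = 0 \<or> x = 0 \<or> y = 0" | "W \<noteq> 0" "0 < x" "0 < y" "k = 0 \<or> m = 0" | "W \<noteq> 0" "0 < k" "0 < m"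
    using x y by (force simp: cell_def)
  then show ?thesis
  proof cases
    case 1
    then have "J = (\<integral>\<^sup>+z. 0 \<partial>(lebesgue :: real measure))"
      unfolding J_def using tri_kernel_outside[OF x y] tri_kernel_zero[of x y]
      by (intro nn_integral_cong) (auto simp: indicator_def W_def XYZ)
    then show ?thesis by (intro reduce[of 0]) (use W0 A in auto)
  next
    case 2
    have W: "2 powr (- 2 * \<alpha>) * Z powr (- 2 * \<alpha> - 1) \<le> W"
    proof (cases "k = 0")
      case True
      then show ?thesis using tri_weight_unit_ge[of \<alpha> Y Z] 2 a XYZ1 by (simp add: W_def XYZ)
    next
      case False
      then have "m = 0" using 2 by simp
      then have "W = tri_weight \<alpha> 1 X Z" unfolding W_def by (simp add: XYZ tri_weight_swap12)
      then show ?thesis using tri_weight_unit_ge[of \<alpha> X Z] 2 a XYZ1 by simp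
    qed
    show ?thesis
    proof (rule reduce[of "4 * A"])
      show "J \<le> ennreal (4 * A)"
        unfolding J_def A_def using tri_kernel_mass_le[OF a 2(2,3)] .
      have "2 powr (2 * \<alpha> + 2) * Z powr (- 2 * \<alpha> - 1) * (4 * A)
          = A * 2 powr (4 * \<alpha> + 4) * (2 powr (- 2 * \<alpha>) * Z powr (- 2 * \<alpha> - 1))"
      proof -
        have "2 powr (4 * \<alpha> + 4) * 2 powr (- 2 * \<alpha>) = 2 powr (2 * \<alpha> + 2 + 2)"
          by (simp add: add.commute flip: powr_add)
        also have "\<dots> = 2 powr (2 * \<alpha> + 2) * 4" by (subst powr_add) simp
        finally show ?thesis by (simp add: ac_simps)
      qed
      also have "\<dots> \<le> A * 2 powr (4 * \<alpha> + 4) * W"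
        using A W by (intro mult_left_mono) auto
      finally show "2 powr (2 * \<alpha> + 2) * Z powr (- 2 * \<alpha> - 1) * (4 * A) \<le> A * 2 powr (4 * \<alpha> + 4) * W" .
    qed (use A in auto)
  next
    case 3
    define B where "B = A * 2 powr (2 * \<alpha> + 1) * Z powr (2 * \<alpha> + 1) * W"
    have B: "0 \<le> B" using A W0 by (simp add: B_def)
    have x1: "X \<le> 2 * x" "0 < x" "X \<ge> 2" and y1: "Y \<le> 2 * y" "0 < y" "Y \<ge> 2"
      using x y 3 by (auto simp: cell_def XYZ)
    have W: "W = max X (max Y Z) powr (1 - 2 * \<alpha>) / (X * Y * Z)"
      using 3(1) by (auto simp: W_def tri_weight_def split: if_splits)
    have le: "tri_kernel \<alpha> x y z * z powr (2 * \<alpha> + 1) \<le> B" if z: "z \<in> cell n" for z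
    proof (cases "z = 0")
      case True
      then show ?thesis using B by simp
    next
      case False
      then have z0: "0 < z" and zZ: "z \<le> Z" using z by (auto simp: cell_def XYZ)
      \<comment> \<open>Here \<open>z\<close> may be much smaller than \<open>Z\<close> when n = 0,
        but then \<open>Z = 1\<close> does not exceed \<open>X\<close> and drops out of the
        maximum.\<close>
      have maxle: "max X (max Y Z) / 2 \<le> max x (max y z)"
      proof (cases "n = 0")
        case True
        then have "max X (max Y Z) = max X Y" using XYZ1 by (simp add: XYZ)
        then show ?thesis using x1 y1 by (auto simp: max_def)
      next
        case False
        then have "Z \<le> 2 * z" using z by (auto simp: cell_def XYZ)
        then show ?thesis using x1 y1 by (auto simp: max_def)
      qed
      have "tri_weight \<alpha> x y z * z powr (2 * \<alpha> + 1)
          \<le> max x (max y z) powr (1 - 2 * \<alpha>) / (x * y * z) * z powr (2 * \<alpha> + 1)"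
        using x1 y1 z0 by (intro mult_right_mono) (auto simp: tri_weight_def)
      \<comment> \<open>Cancelling one power of \<open>z\<close> first removes the singularity at 0,
        so that \<open>z <= Z\<close> suffices.\<close>
      also have "\<dots> = max x (max y z) powr (1 - 2 * \<alpha>) * z powr (2 * \<alpha>) / (x * y)"
        using z0 by (simp add: powr_add field_simps)
      also have "\<dots> \<le> (max X (max Y Z) / 2) powr (1 - 2 * \<alpha>) * Z powr (2 * \<alpha>) / ((X / 2) * (Y / 2))"
        using x1 y1 z0 zZ maxle a XYZ1
        by (intro frac_le mult_mono powr_mono2' powr_mono2 mult_pos_pos) (auto simp: less_max_iff_disj)
      \<comment> \<open>Halving costs \<open>2 powr (2 * \<alpha> - 1)\<close> in the maximum and 4
        in the denominator.\<close>
      also have "\<dots> = 2 powr (2 * \<alpha> + 1) * Z powr (2 * \<alpha> + 1) * W"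
        using XYZ1 unfolding W
        by (simp add: powr_divide powr_add powr_diff field_simps)
      finally have "A * (tri_weight \<alpha> x y z * z powr (2 * \<alpha> + 1)) \<le> B"
        using A unfolding B_def by (simp add: mult.assoc)
      moreover have "tri_kernel \<alpha> x y z * z powr (2 * \<alpha> + 1) \<le> A * tri_weight \<alpha> x y z * z powr (2 * \<alpha> + 1)"
        unfolding A_def using tri_kernel_le[OF a x1(2) y1(2) z0] by (intro mult_right_mono) auto
      ultimately show ?thesis by (simp add: mult.assoc)
    qed
    show ?thesis
    proof (rule reduce[OF _ B])
      have "J \<le> (\<integral>\<^sup>+z. ennreal B * indicator (cell n) z \<partial>lebesgue)"
        unfolding J_def using le by (intro nn_integral_mono) (auto simp: indicator_def intro!: ennreal_leI)
      also have "\<dots> = ennreal B"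
        using emeasure_lebesgue_cell by (subst nn_integral_cmult_indicator) auto
      finally show "J \<le> ennreal B" .
      have "2 powr (2 * \<alpha> + 2) * Z powr (- 2 * \<alpha> - 1) * B
         = A * (2 powr (2 * \<alpha> + 2) * 2 powr (2 * \<alpha> + 1)) * (Z powr (- 2 * \<alpha> - 1) * Z powr (2 * \<alpha> + 1)) * W"
        by (simp add: B_def ac_simps)
      also have "\<dots> = A * 2 powr (4 * \<alpha> + 3) * W"
        using XYZ1 by (simp flip: powr_add)
      also have "\<dots> \<le> A * 2 powr (4 * \<alpha> + 4) * W"
        using A W0 by (intro mult_right_mono mult_left_mono powr_mono) auto
      finally show "2 powr (2 * \<alpha> + 2) * Z powr (- 2 * \<alpha> - 1) * B \<le> A * 2 powr (4 * \<alpha> + 4) * W" .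
    qed
  qed
qed

text \<open>With u <= v the two fixed shifted indices, the triangle condition gives
  \<open>real n + 1 <= u + v <= 2 * v\<close>, so each term is at most 2/u. At most 2(u - 1) + 3 <=
  3u terms are nonzero, whence 6.\<close>

lemma tri_weight_sum_le:
  assumes a: "1/2 \<le> \<alpha>"
  shows "(\<Sum>n. cell_meas \<alpha> n * ennreal (tri_weight \<alpha> (real k + 1) (real m + 1) (real n + 1))) \<le> 6"
proof -
  define u v where uv: "u = min (real k + 1) (real m + 1)" "v = max (real k + 1) (real m + 1)"
  have uv1: "1 \<le> u" "u \<le> v" "u * v = (real k + 1) * (real m + 1)" "u + v = (real k + 1) + (real m + 1)"
    by (auto simp: uv min_def max_def)
  define S where "S = {n. tri_weight \<alpha> (real k + 1) (real m + 1) (real n + 1) \<noteq> 0}"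
  define i j where ij: "i = min k m" "j = max k m"
  \<comment> \<open>Natural subtraction truncates to 0 when i = j, which only shortens the
    interval.\<close>
  have S: "S \<subseteq> {j - i - 1..j + i + 1}"
    by (auto simp: S_def tri_weight_def ij split: if_splits)
  then have fin: "finite S" by (rule finite_subset) simp
  have "card S \<le> card {j - i - 1..j + i + 1}" by (intro card_mono S) simp
  also have "\<dots> \<le> 2 * i + 3" by simp
  finally have card: "real (card S) \<le> 3 * u"
    unfolding uv ij by (simp add: min_def split: if_splits)
  have "(\<Sum>n. cell_meas \<alpha> n * ennreal (tri_weight \<alpha> (real k + 1) (real m + 1) (real n + 1)))
      = (\<Sum>n\<in>S. cell_meas \<alpha> n * ennreal (tri_weight \<alpha> (real k + 1) (real m + 1) (real n + 1)))"
    by (intro suminf_finite fin) (auto simp: S_def)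
  also have "\<dots> \<le> (\<Sum>n\<in>S. ennreal (2 / u))"
  proof (intro sum_mono)
    fix n assume n: "n \<in> S"
    have "cell_meas \<alpha> n * ennreal (tri_weight \<alpha> (real k + 1) (real m + 1) (real n + 1))
      \<le> ennreal ((real n + 1) powr (2 * \<alpha> + 1)) * ennreal (tri_weight \<alpha> (real k + 1) (real m + 1) (real n + 1))"
      by (intro mult_right_mono cell_meas_upper a) auto
    also have "\<dots> = ennreal ((real n + 1) powr (2 * \<alpha> + 1) * tri_weight \<alpha> (real k + 1) (real m + 1) (real n + 1))"
      using tri_weight_nonneg by (intro ennreal_mult[symmetric]) auto
    also have "\<dots> \<le> ennreal (2 / u)"
    proof (rule ennreal_leI)
      have "(real n + 1) powr (2 * \<alpha> + 1) * tri_weight \<alpha> (real k + 1) (real m + 1) (real n + 1)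
        \<le> (real n + 1) / (u * v)"
        using tri_weight_mult_powr_le[OF a, of "real k + 1" "real m + 1" "real n + 1"] uv1 by simp
      also have "\<dots> \<le> (2 * v) / (u * v)"
      proof (intro divide_right_mono)
        have "real n + 1 \<le> u + v" using n unfolding uv1(4)
          by (auto simp: S_def tri_weight_def split: if_splits)
        then show "real n + 1 \<le> 2 * v" using uv1 by simp
      qed (use uv1 in auto)
      also have "\<dots> = 2 / u" using uv1(1,2) by simp
      finally show "(real n + 1) powr (2 * \<alpha> + 1) * tri_weight \<alpha> (real k + 1) (real m + 1) (real n + 1) \<le> 2 / u" .
    qed
    finally show "cell_meas \<alpha> n * ennreal (tri_weight \<alpha> (real k + 1) (real m + 1) (real n + 1)) \<le> ennreal (2 / u)" .
  qed
  also have "\<dots> = ennreal (real (card S) * (2 / u))"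
    using uv1(1) by (simp add: ennreal_of_nat_eq_real_of_nat ennreal_mult[symmetric])
  also have "\<dots> \<le> ennreal (3 * u * (2 / u))"
    using card uv1 by (intro ennreal_leI mult_right_mono) auto
  also have "3 * u * (2 / u) = 6" using uv1 by simp
  finally show ?thesis by simp
qed

section \<open>Local estimates\<close>

lemma tri_kernel_measurable_compose:
  assumes "u \<in> borel_measurable M" "v \<in> borel_measurable M" "w \<in> borel_measurable M"
  shows "(\<lambda>q. ennreal (tri_kernel \<alpha> (u q) (v q) (w q))) \<in> borel_measurable M"
proof -
  have "(\<lambda>q. (u q, v q, w q)) \<in> M \<rightarrow>\<^sub>M borel \<Otimes>\<^sub>M (borel \<Otimes>\<^sub>M borel)"
    using assms by measurable
  from measurable_compose[OF this tri_kernel_measurable] show ?thesis by simp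
qed

lemmas measurable_cell_prob_borel = measurable_cell_prob[OF measurable_lebesgue_ident]

definition bk_cell_int :: "real \<Rightarrow> (real \<Rightarrow> ennreal) \<Rightarrow> (real \<Rightarrow> ennreal) \<Rightarrow> nat \<Rightarrow> nat \<Rightarrow> real \<Rightarrow> ennreal" where
  "bk_cell_int \<alpha> f g m n x =
     (\<integral>\<^sup>+y. \<integral>\<^sup>+z. ennreal (tri_kernel \<alpha> x y z) * f y * g z \<partial>cell_prob \<alpha> n \<partial>cell_prob \<alpha> m)"

lemma bk_cell_int_measurable:
  assumes a: "1/2 \<le> \<alpha>" and f: "f \<in> borel_measurable lebesgue" and g: "g \<in> borel_measurable lebesgue"
  shows "bk_cell_int \<alpha> f g m n \<in> borel_measurable lebesgue"
proof -
  interpret M: sigma_finite_measure "cell_prob \<alpha> m" by (rule sigma_finite_cell_prob[OF a])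
  interpret N: sigma_finite_measure "cell_prob \<alpha> n" by (rule sigma_finite_cell_prob[OF a])
  note [measurable] = measurable_cell_prob[OF f] measurable_cell_prob[OF g]
  let ?P = "(lebesgue \<Otimes>\<^sub>M cell_prob \<alpha> m) \<Otimes>\<^sub>M cell_prob \<alpha> n"
  have "(\<lambda>q. fst (fst q)) \<in> borel_measurable ?P"
    by (rule measurable_compose[OF measurable_compose[OF measurable_fst measurable_fst] measurable_lebesgue_ident])
  moreover have "(\<lambda>q. snd (fst q)) \<in> borel_measurable ?P"
    by (rule measurable_compose[OF measurable_compose[OF measurable_fst measurable_snd] measurable_cell_prob_borel])
  moreover have "(\<lambda>q. snd q) \<in> borel_measurable ?P"
    by (rule measurable_compose[OF measurable_snd measurable_cell_prob_borel])
  ultimately have [measurable]: "(\<lambda>q. ennreal (tri_kernel \<alpha> (fst (fst q)) (snd (fst q)) (snd q))) \<in> borel_measurable ?P"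
    by (rule tri_kernel_measurable_compose)
  have "(\<lambda>q. ennreal (tri_kernel \<alpha> (fst (fst q)) (snd (fst q)) (snd q)) * f (snd (fst q)) * g (snd q)) \<in> borel_measurable ?P"
    by measurable
  then have "(\<lambda>r. \<integral>\<^sup>+z. (\<lambda>q. ennreal (tri_kernel \<alpha> (fst (fst q)) (snd (fst q)) (snd q)) * f (snd (fst q)) * g (snd q)) (r, z) \<partial>cell_prob \<alpha> n)
      \<in> borel_measurable (lebesgue \<Otimes>\<^sub>M cell_prob \<alpha> m)"
    by (rule N.borel_measurable_nn_integral_fst)
  then have "(\<lambda>x. \<integral>\<^sup>+y. (\<lambda>r. \<integral>\<^sup>+z. (\<lambda>q. ennreal (tri_kernel \<alpha> (fst (fst q)) (snd (fst q)) (snd q)) * f (snd (fst q)) * g (snd q)) (r, z) \<partial>cell_prob \<alpha> n)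
     (x, y) \<partial>cell_prob \<alpha> m) \<in> borel_measurable lebesgue"
    by (rule M.borel_measurable_nn_integral_fst)
  then show ?thesis by (simp add: bk_cell_int_def[abs_def])
qed

lemma Lp_zero: "1 \<le> p \<Longrightarrow> Lp M p (\<lambda>x. 0) = 0"
  using Lp_cmult[of "\<lambda>x. 0" M p 0] by simp

text \<open>Young's inequality on three cells, the other two marginals coming from the symmetry of
  kernel and weight. Since that theorem requires a positive marginal bound, triples of weight 0 are
  treated separately; the kernel vanishes on them.\<close>

lemma bk_cell_int_Lp_le:
  assumes a: "1/2 \<le> \<alpha>" and f: "f \<in> borel_measurable lebesgue" and g: "g \<in> borel_measurable lebesgue"
    and exps: "1 \<le> p1" "1 \<le> p2" "1 \<le> p" "inv_exp p = inv_exp p1 + inv_exp p2 - 1"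
  shows "Lp (cell_prob \<alpha> k) p (bk_cell_int \<alpha> f g m n)
    \<le> ennreal (tri_const \<alpha> * tri_weight \<alpha> (real k + 1) (real m + 1) (real n + 1))
       * Lp (cell_prob \<alpha> m) p1 f * Lp (cell_prob \<alpha> n) p2 g"
proof (cases "tri_weight \<alpha> (real k + 1) (real m + 1) (real n + 1) = 0")
  case True
  have "bk_cell_int \<alpha> f g m n x = 0" if "x \<in> cell k" for x
  proof -
    have "bk_cell_int \<alpha> f g m n x = (\<integral>\<^sup>+y. \<integral>\<^sup>+z. 0 \<partial>cell_prob \<alpha> n \<partial>cell_prob \<alpha> m)"
      unfolding bk_cell_int_def
      using tri_kernel_outside[OF that _ _ True] by (intro nn_integral_cong) auto
    then show ?thesis by simp
  qed
  then have "Lp (cell_prob \<alpha> k) p (bk_cell_int \<alpha> f g m n) = Lp (cell_prob \<alpha> k) p (\<lambda>x. 0)"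
    by (intro Lp_cong) simp
  then show ?thesis using exps by (simp add: Lp_zero)
next
  case False
  let ?W = "tri_weight \<alpha> (real k + 1) (real m + 1) (real n + 1)"
  let ?P = "cell_prob \<alpha> k \<Otimes>\<^sub>M (cell_prob \<alpha> m \<Otimes>\<^sub>M cell_prob \<alpha> n)"
  have nonneg: "0 \<le> x" if "x \<in> cell i" for x i using that by (auto simp: cell_def)
  have W: "0 < ?W" using False tri_weight_nonneg[of \<alpha> k m n] by simp
  have "(\<lambda>q. ennreal (tri_kernel \<alpha> (fst q) (fst (snd q)) (snd (snd q)))) \<in> borel_measurable ?P"
  proof (rule tri_kernel_measurable_compose)
    show "fst \<in> borel_measurable ?P"
      by (rule measurable_compose[OF measurable_fst measurable_cell_prob_borel])
    show "(\<lambda>q. fst (snd q)) \<in> borel_measurable ?P"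
      by (rule measurable_compose[OF measurable_compose[OF measurable_snd measurable_fst] measurable_cell_prob_borel])
    show "(\<lambda>q. snd (snd q)) \<in> borel_measurable ?P"
      by (rule measurable_compose[OF measurable_compose[OF measurable_snd measurable_snd] measurable_cell_prob_borel])
  qed
  then have meas: "(\<lambda>(x, y, z). ennreal (tri_kernel \<alpha> x y z)) \<in> borel_measurable ?P"
    by (simp add: case_prod_beta')
  show ?thesis unfolding bk_cell_int_def[abs_def]
  proof (rule Young_kernel[OF sigma_finite_cell_prob[OF a] sigma_finite_cell_prob[OF a]
        sigma_finite_cell_prob[OF a] meas _ _ _ _ _ measurable_cell_prob[OF f] measurable_cell_prob[OF g] exps])
    fix x y assume "x \<in> space (cell_prob \<alpha> k)" "y \<in> space (cell_prob \<alpha> m)"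
    then show "(\<integral>\<^sup>+z. ennreal (tri_kernel \<alpha> x y z) \<partial>cell_prob \<alpha> n) \<le> ennreal (tri_const \<alpha> * ?W)"
      by (intro tri_kernel_cell_integral_le[OF a]) auto
  next
    fix x z assume xz: "x \<in> space (cell_prob \<alpha> k)" "z \<in> space (cell_prob \<alpha> n)"
    have "(\<integral>\<^sup>+y. ennreal (tri_kernel \<alpha> x y z) \<partial>cell_prob \<alpha> m) = (\<integral>\<^sup>+y. ennreal (tri_kernel \<alpha> x z y) \<partial>cell_prob \<alpha> m)"
      using xz by (intro nn_integral_cong) (auto simp: tri_kernel_swap23 dest!: nonneg)
    also have "\<dots> \<le> ennreal (tri_const \<alpha> * tri_weight \<alpha> (real k + 1) (real n + 1) (real m + 1))"
      using xz by (intro tri_kernel_cell_integral_le[OF a]) auto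
    finally show "(\<integral>\<^sup>+y. ennreal (tri_kernel \<alpha> x y z) \<partial>cell_prob \<alpha> m) \<le> ennreal (tri_const \<alpha> * ?W)"
      by (simp only: tri_weight_swap23[of \<alpha> _ "real m + 1" "real n + 1"])
  next
    fix y z assume yz: "y \<in> space (cell_prob \<alpha> m)" "z \<in> space (cell_prob \<alpha> n)"
    have "(\<integral>\<^sup>+x. ennreal (tri_kernel \<alpha> x y z) \<partial>cell_prob \<alpha> k) = (\<integral>\<^sup>+x. ennreal (tri_kernel \<alpha> y z x) \<partial>cell_prob \<alpha> k)"
    proof (intro nn_integral_cong)
      fix x assume "x \<in> space (cell_prob \<alpha> k)"
      then show "ennreal (tri_kernel \<alpha> x y z) = ennreal (tri_kernel \<alpha> y z x)"
        using yz tri_kernel_swap12[of \<alpha> x y z] tri_kernel_swap23[of y x z \<alpha>] nonneg by auto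
    qed
    also have "\<dots> \<le> ennreal (tri_const \<alpha> * tri_weight \<alpha> (real m + 1) (real n + 1) (real k + 1))"
      using yz by (intro tri_kernel_cell_integral_le[OF a]) auto
    also have "tri_weight \<alpha> (real m + 1) (real n + 1) (real k + 1) = ?W"
      by (metis tri_weight_swap12 tri_weight_swap23)
    finally show "(\<integral>\<^sup>+x. ennreal (tri_kernel \<alpha> x y z) \<partial>cell_prob \<alpha> k) \<le> ennreal (tri_const \<alpha> * ?W)" .
  qed (use W tri_const_pos[OF a] in \<open>auto intro: mult_pos_pos\<close>)
qed

lemma hyp_trans_nn_eq:
  assumes a: "1/2 \<le> \<alpha>" and "0 < x" "0 < y" and g [measurable]: "g \<in> borel_measurable lebesgue"
  shows "hyp_trans_nn \<alpha> g y x = (\<integral>\<^sup>+z. ennreal (tri_kernel \<alpha> x y z) * g z \<partial>bk_measure \<alpha>)"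
proof -
  have [measurable]: "(\<lambda>z. ennreal (tri_kernel \<alpha> x y z)) \<in> borel_measurable lebesgue"
    by (intro tri_kernel_measurable_compose measurable_lebesgue_ident) auto
  have "(\<integral>\<^sup>+z. ennreal (tri_kernel \<alpha> x y z) * g z \<partial>bk_measure \<alpha>)
     = (\<integral>\<^sup>+z. ennreal (indicator {0..} z * z powr (2 * \<alpha> + 1)) * (ennreal (tri_kernel \<alpha> x y z) * g z) \<partial>lebesgue)"
    by (rule nn_integral_bk_measure) measurable
  also have "\<dots> = (\<integral>\<^sup>+z. ennreal (tri_kernel \<alpha> y x z * z powr (2 * \<alpha> + 1)) * g z \<partial>lebesgue)"
  proof (intro nn_integral_cong)
    fix z
    have eq: "indicator {0..} z * z powr (2 * \<alpha> + 1) * tri_kernel \<alpha> x y z = tri_kernel \<alpha> y x z * z powr (2 * \<alpha> + 1)"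
      unfolding tri_kernel_swap12[of \<alpha> y x] by (auto simp: indicator_def tri_kernel_def)
    have "ennreal (indicator {0..} z * z powr (2 * \<alpha> + 1)) * ennreal (tri_kernel \<alpha> x y z)
       = ennreal (indicator {0..} z * z powr (2 * \<alpha> + 1) * tri_kernel \<alpha> x y z)"
      using tri_kernel_nonneg[OF a] by (intro ennreal_mult[symmetric]) auto
    then show "ennreal (indicator {0..} z * z powr (2 * \<alpha> + 1)) * (ennreal (tri_kernel \<alpha> x y z) * g z)
       = ennreal (tri_kernel \<alpha> y x z * z powr (2 * \<alpha> + 1)) * g z"
      by (simp only: mult.assoc[symmetric] eq)
  qed
  finally show ?thesis using assms(2,3) by (simp add: hyp_trans_nn_def tri_kernel_def)
qed

text \<open>Both integrations are cut into cells. Positivity of \<open>x\<close> is essential: at 0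
  the translation returns the function itself, whereas \<open>tri_kernel\<close> vanishes and the
  right side would be 0.\<close>

lemma hyp_conv_nn_eq_sum:
  assumes a: "1/2 \<le> \<alpha>" and x: "0 < x"
    and f [measurable]: "f \<in> borel_measurable lebesgue" and g [measurable]: "g \<in> borel_measurable lebesgue"
  shows "(\<integral>\<^sup>+y. f y * hyp_trans_nn \<alpha> g y x \<partial>bk_measure \<alpha>)
    = (\<Sum>m. cell_meas \<alpha> m * (\<Sum>n. cell_meas \<alpha> n * bk_cell_int \<alpha> f g m n x))"
proof -
  have k1: "(\<lambda>q. ennreal (tri_kernel \<alpha> x (fst q) (snd q))) \<in> borel_measurable (lebesgue \<Otimes>\<^sub>M bk_measure \<alpha>)"
    by (intro tri_kernel_measurable_compose measurable_compose[OF measurable_fst measurable_lebesgue_ident]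
         measurable_compose[OF measurable_snd]) (auto simp: measurable_cong_sets[OF sets_bk_measure refl])
  note [measurable] = k1
  have "(\<lambda>q. f (fst q) * ennreal (tri_kernel \<alpha> x (fst q) (snd q)) * g (snd q)) \<in> borel_measurable (lebesgue \<Otimes>\<^sub>M bk_measure \<alpha>)"
    by measurable
  from bk.borel_measurable_nn_integral_fst[OF this]
  have meas: "(\<lambda>y. \<integral>\<^sup>+z. f y * ennreal (tri_kernel \<alpha> x y z) * g z \<partial>bk_measure \<alpha>) \<in> borel_measurable lebesgue"
    by simp
  have k2 [measurable]: "(\<lambda>z. ennreal (tri_kernel \<alpha> x y z)) \<in> borel_measurable lebesgue" for y
    by (intro tri_kernel_measurable_compose measurable_lebesgue_ident) auto
  have "(\<integral>\<^sup>+y. f y * hyp_trans_nn \<alpha> g y x \<partial>bk_measure \<alpha>)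
      = (\<integral>\<^sup>+y. \<integral>\<^sup>+z. f y * ennreal (tri_kernel \<alpha> x y z) * g z \<partial>bk_measure \<alpha> \<partial>bk_measure \<alpha>)"
  proof (rule nn_integral_cong_AE, use AE_bk_measure_pos[of \<alpha>] in eventually_elim)
    case (elim y)
    then show ?case
      by (simp add: hyp_trans_nn_eq[OF a x elim g] nn_integral_cmult mult.assoc)
  qed
  also have "\<dots> = (\<Sum>m. cell_meas \<alpha> m * (\<integral>\<^sup>+y. \<integral>\<^sup>+z. f y * ennreal (tri_kernel \<alpha> x y z) * g z \<partial>bk_measure \<alpha> \<partial>cell_prob \<alpha> m))"
    by (rule nn_integral_bk_measure_cells[OF a meas])
  also have "\<dots> = (\<Sum>m. cell_meas \<alpha> m * (\<Sum>n. cell_meas \<alpha> n * bk_cell_int \<alpha> f g m n x))"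
  proof (intro suminf_cong arg_cong2[where f = "(*)"] refl)
    fix m
    have inner_meas: "(\<lambda>y. \<integral>\<^sup>+z. f y * ennreal (tri_kernel \<alpha> x y z) * g z \<partial>cell_prob \<alpha> n) \<in> borel_measurable (cell_prob \<alpha> m)" for n
    proof -
      interpret N: sigma_finite_measure "cell_prob \<alpha> n" by (rule sigma_finite_cell_prob[OF a])
      note [measurable] = measurable_cell_prob[OF f] measurable_cell_prob[OF g]
      have [measurable]: "(\<lambda>q. ennreal (tri_kernel \<alpha> x (fst q) (snd q))) \<in> borel_measurable (cell_prob \<alpha> m \<Otimes>\<^sub>M cell_prob \<alpha> n)"
        by (intro tri_kernel_measurable_compose measurable_compose[OF measurable_fst measurable_cell_prob_borel]
           measurable_compose[OF measurable_snd measurable_cell_prob_borel]) auto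
      have "(\<lambda>q. f (fst q) * ennreal (tri_kernel \<alpha> x (fst q) (snd q)) * g (snd q)) \<in> borel_measurable (cell_prob \<alpha> m \<Otimes>\<^sub>M cell_prob \<alpha> n)"
        by measurable
      from N.borel_measurable_nn_integral_fst[OF this] show ?thesis by simp
    qed
    have "(\<integral>\<^sup>+y. \<integral>\<^sup>+z. f y * ennreal (tri_kernel \<alpha> x y z) * g z \<partial>bk_measure \<alpha> \<partial>cell_prob \<alpha> m)
      = (\<integral>\<^sup>+y. (\<Sum>n. cell_meas \<alpha> n * (\<integral>\<^sup>+z. f y * ennreal (tri_kernel \<alpha> x y z) * g z \<partial>cell_prob \<alpha> n)) \<partial>cell_prob \<alpha> m)"
      by (intro nn_integral_cong nn_integral_bk_measure_cells[OF a]) measurable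
    also have "\<dots> = (\<Sum>n. \<integral>\<^sup>+y. cell_meas \<alpha> n * (\<integral>\<^sup>+z. f y * ennreal (tri_kernel \<alpha> x y z) * g z \<partial>cell_prob \<alpha> n) \<partial>cell_prob \<alpha> m)"
      by (intro nn_integral_suminf borel_measurable_times_ennreal measurable_const inner_meas) simp
    also have "\<dots> = (\<Sum>n. cell_meas \<alpha> n * bk_cell_int \<alpha> f g m n x)"
      unfolding bk_cell_int_def
      by (intro suminf_cong, subst nn_integral_cmult[OF inner_meas]) (simp add: mult.commute)
    finally show "(\<integral>\<^sup>+y. \<integral>\<^sup>+z. f y * ennreal (tri_kernel \<alpha> x y z) * g z \<partial>bk_measure \<alpha> \<partial>cell_prob \<alpha> m)
      = (\<Sum>n. cell_meas \<alpha> n * bk_cell_int \<alpha> f g m n x)" .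
  qed
  finally show ?thesis .
qed

section \<open>Convolution on the amalgams\<close>

definition amalgam_conv :: "real \<Rightarrow> (nat \<Rightarrow> ennreal) \<Rightarrow> (nat \<Rightarrow> ennreal) \<Rightarrow> nat \<Rightarrow> ennreal" where
  "amalgam_conv \<alpha> a b k = (\<integral>\<^sup>+m. \<integral>\<^sup>+n. ennreal (tri_const \<alpha> * tri_weight \<alpha> (real k + 1) (real m + 1) (real n + 1))
      * a m * b n \<partial>cell_count \<alpha> \<partial>cell_count \<alpha>)"

definition bk_cell_sum :: "real \<Rightarrow> (real \<Rightarrow> ennreal) \<Rightarrow> (real \<Rightarrow> ennreal) \<Rightarrow> real \<Rightarrow> ennreal" where
  "bk_cell_sum \<alpha> f g x = (\<Sum>m. cell_meas \<alpha> m * (\<Sum>n. cell_meas \<alpha> n * bk_cell_int \<alpha> f g m n x))"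

lemma bk_cell_sum_measurable:
  assumes "1/2 \<le> \<alpha>" "f \<in> borel_measurable lebesgue" "g \<in> borel_measurable lebesgue"
  shows "bk_cell_sum \<alpha> f g \<in> borel_measurable lebesgue"
proof -
  note [measurable] = bk_cell_int_measurable[OF assms]
  show ?thesis unfolding bk_cell_sum_def[abs_def] by measurable
qed

lemma bk_cell_sum_Lp_le:
  assumes a: "1/2 \<le> \<alpha>" and f: "f \<in> borel_measurable lebesgue" and g: "g \<in> borel_measurable lebesgue"
    and exps: "1 \<le> p1" "1 \<le> p2" "1 \<le> p" "inv_exp p = inv_exp p1 + inv_exp p2 - 1"
  shows "Lp (cell_prob \<alpha> k) p (bk_cell_sum \<alpha> f g)
    \<le> amalgam_conv \<alpha> (\<lambda>m. Lp (cell_prob \<alpha> m) p1 f) (\<lambda>n. Lp (cell_prob \<alpha> n) p2 g) k"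
proof -
  note meas = measurable_cell_prob[OF bk_cell_int_measurable[OF a f g]]
  note [measurable] = meas
  have "Lp (cell_prob \<alpha> k) p (bk_cell_sum \<alpha> f g)
     \<le> (\<Sum>m. Lp (cell_prob \<alpha> k) p (\<lambda>x. cell_meas \<alpha> m * (\<Sum>n. cell_meas \<alpha> n * bk_cell_int \<alpha> f g m n x)))"
    unfolding bk_cell_sum_def[abs_def] by (intro Lp_suminf_le exps(3)) measurable
  also have "\<dots> \<le> (\<Sum>m. cell_meas \<alpha> m * (\<Sum>n. cell_meas \<alpha> n *
      (ennreal (tri_const \<alpha> * tri_weight \<alpha> (real k + 1) (real m + 1) (real n + 1))
       * Lp (cell_prob \<alpha> m) p1 f * Lp (cell_prob \<alpha> n) p2 g)))"
  proof (intro suminf_le)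
    fix m
    have "Lp (cell_prob \<alpha> k) p (\<lambda>x. cell_meas \<alpha> m * (\<Sum>n. cell_meas \<alpha> n * bk_cell_int \<alpha> f g m n x))
       = cell_meas \<alpha> m * Lp (cell_prob \<alpha> k) p (\<lambda>x. \<Sum>n. cell_meas \<alpha> n * bk_cell_int \<alpha> f g m n x)"
      by (intro Lp_cmult exps(3)) measurable
    also have "\<dots> \<le> cell_meas \<alpha> m * (\<Sum>n. Lp (cell_prob \<alpha> k) p (\<lambda>x. cell_meas \<alpha> n * bk_cell_int \<alpha> f g m n x))"
      by (intro mult_left_mono Lp_suminf_le exps(3) borel_measurable_times_ennreal measurable_const meas) simp_all
    also have "\<dots> = cell_meas \<alpha> m * (\<Sum>n. cell_meas \<alpha> n * Lp (cell_prob \<alpha> k) p (bk_cell_int \<alpha> f g m n))"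
      by (simp only: Lp_cmult[OF meas exps(3)])
    also have "\<dots> \<le> cell_meas \<alpha> m * (\<Sum>n. cell_meas \<alpha> n *
      (ennreal (tri_const \<alpha> * tri_weight \<alpha> (real k + 1) (real m + 1) (real n + 1))
       * Lp (cell_prob \<alpha> m) p1 f * Lp (cell_prob \<alpha> n) p2 g))"
      by (intro mult_left_mono suminf_le bk_cell_int_Lp_le[OF a f g exps]) auto
    finally show "Lp (cell_prob \<alpha> k) p (\<lambda>x. cell_meas \<alpha> m * (\<Sum>n. cell_meas \<alpha> n * bk_cell_int \<alpha> f g m n x))
      \<le> cell_meas \<alpha> m * (\<Sum>n. cell_meas \<alpha> n *
      (ennreal (tri_const \<alpha> * tri_weight \<alpha> (real k + 1) (real m + 1) (real n + 1))
       * Lp (cell_prob \<alpha> m) p1 f * Lp (cell_prob \<alpha> n) p2 g))" .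
  qed auto
  finally show ?thesis by (simp add: amalgam_conv_def nn_integral_cell_count)
qed

text \<open>The supremum norm sees the single point 0, where the convolution is \<open>\<integral>f g d\<omega>\<close> and not given by
  the kernel.\<close>

lemma hyp_conv_nn_at_0_le:
  assumes a: "1/2 \<le> \<alpha>" and f [measurable]: "f \<in> borel_measurable lebesgue"
    and g [measurable]: "g \<in> borel_measurable lebesgue"
    and exps: "1 \<le> p1" "1 \<le> p2" "inv_exp p1 + inv_exp p2 = 1"
  shows "(\<integral>\<^sup>+y. f y * hyp_trans_nn \<alpha> g y 0 \<partial>bk_measure \<alpha>)
    \<le> amalgam_conv \<alpha> (\<lambda>m. Lp (cell_prob \<alpha> m) p1 f) (\<lambda>n. Lp (cell_prob \<alpha> n) p2 g) 0"
proof -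
  define a' where "a' m = Lp (cell_prob \<alpha> m) p1 f" for m
  define b' where "b' n = Lp (cell_prob \<alpha> n) p2 g" for n
  have "(\<integral>\<^sup>+y. f y * hyp_trans_nn \<alpha> g y 0 \<partial>bk_measure \<alpha>) = (\<integral>\<^sup>+y. f y * g y \<partial>bk_measure \<alpha>)"
    by (intro nn_integral_cong) (simp add: hyp_trans_nn_def)
  also have "\<dots> = (\<Sum>n. cell_meas \<alpha> n * (\<integral>\<^sup>+y. f y * g y \<partial>cell_prob \<alpha> n))"
    by (rule nn_integral_bk_measure_cells[OF a]) measurable
  also have "\<dots> \<le> (\<Sum>n. cell_meas \<alpha> n * (a' n * b' n))"
    unfolding a'_def b'_def using exps
    by (intro suminf_le mult_left_mono Lp_Holder measurable_cell_prob f g) auto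
  also have "\<dots> \<le> (\<Sum>m. cell_meas \<alpha> m * (\<Sum>n. cell_meas \<alpha> n *
      (ennreal (tri_const \<alpha> * tri_weight \<alpha> (real 0 + 1) (real m + 1) (real n + 1)) * a' m * b' n)))"
  proof (intro suminf_le mult_left_mono)
    fix m
    \<comment> \<open>The diagonal term n = m alone dominates. The weight of the sides 1, N, N is
      \<open>N powr (- 2 * \<alpha> - 1)\<close>, the reciprocal of the cell mass up to a constant,
      and the second summand of \<open>tri_const\<close> compensates that constant.\<close>
    have "1 \<le> cell_meas \<alpha> m * ennreal (tri_const \<alpha> * tri_weight \<alpha> (real 0 + 1) (real m + 1) (real m + 1))"
    proof -
      have w: "tri_weight \<alpha> (real 0 + 1) (real m + 1) (real m + 1) = (real m + 1) powr (- 2 * \<alpha> - 1)"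
      proof -
        have "tri_weight \<alpha> 1 N N = N powr (- 2 * \<alpha> - 1)" if "1 \<le> N" for N
        proof -
          have "N powr (- 2 * \<alpha> - 1) = N powr ((1 - 2 * \<alpha>) - 2)"
            by (intro arg_cong2[where f = "(powr)"] refl) simp
          also have "\<dots> = N powr (1 - 2 * \<alpha>) / (N * N)"
            using that by (simp only: powr_diff) (simp add: power2_eq_square)
          finally show ?thesis using that by (simp add: tri_weight_def max_def)
        qed
        from this[of "real m + 1"] show ?thesis by simp
      qed
      have "1 = ennreal (2 powr (- 2 * \<alpha> - 2) * (real m + 1) powr (2 * \<alpha> + 1)
          * (2 powr (2 * \<alpha> + 2) * (real m + 1) powr (- 2 * \<alpha> - 1)))"
      proof -
        have "2 powr (- 2 * \<alpha> - 2) * (real m + 1) powr (2 * \<alpha> + 1)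
          * (2 powr (2 * \<alpha> + 2) * (real m + 1) powr (- 2 * \<alpha> - 1))
          = (2 powr (- 2 * \<alpha> - 2) * 2 powr (2 * \<alpha> + 2))
          * ((real m + 1) powr (2 * \<alpha> + 1) * (real m + 1) powr (- 2 * \<alpha> - 1))"
          by (simp only: ac_simps)
        also have "\<dots> = 1" by (simp flip: powr_add)
        finally show ?thesis by simp
      qed
      also have "\<dots> = ennreal (2 powr (- 2 * \<alpha> - 2) * (real m + 1) powr (2 * \<alpha> + 1))
          * ennreal (2 powr (2 * \<alpha> + 2) * (real m + 1) powr (- 2 * \<alpha> - 1))"
        by (intro ennreal_mult) auto
      also have "\<dots> \<le> cell_meas \<alpha> m * ennreal (tri_const \<alpha> * (real m + 1) powr (- 2 * \<alpha> - 1))"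
        using C_Gamma_pos[OF a]
        by (intro mult_mono cell_meas_lower[OF a] ennreal_leI mult_right_mono) (auto simp: tri_const_def)
      finally show ?thesis by (simp only: w)
    qed
    then have "1 * (a' m * b' m) \<le> (cell_meas \<alpha> m *
        ennreal (tri_const \<alpha> * tri_weight \<alpha> (real 0 + 1) (real m + 1) (real m + 1))) * (a' m * b' m)"
      by (intro mult_right_mono) auto
    also have "\<dots> = (\<Sum>n\<in>{m}. cell_meas \<alpha> n *
      (ennreal (tri_const \<alpha> * tri_weight \<alpha> (real 0 + 1) (real m + 1) (real n + 1)) * a' m * b' n))"
      by (simp add: mult.assoc)
    also have "\<dots> \<le> (\<Sum>n. cell_meas \<alpha> n *
      (ennreal (tri_const \<alpha> * tri_weight \<alpha> (real 0 + 1) (real m + 1) (real n + 1)) * a' m * b' n))"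
      by (rule sum_le_suminf) auto
    finally show "a' m * b' m \<le> (\<Sum>n. cell_meas \<alpha> n *
      (ennreal (tri_const \<alpha> * tri_weight \<alpha> (real 0 + 1) (real m + 1) (real n + 1)) * a' m * b' n))" by simp
  qed auto
  finally show ?thesis by (simp add: amalgam_conv_def nn_integral_cell_count a'_def b'_def)
qed

text \<open>For finite exponents the point 0 is negligible. For \<open>p = \<infinity>\<close> it is
  not, but the exponent relation then becomes the conjugacy needed at 0.\<close>

lemma hyp_conv_nn_Lp_le:
  assumes a: "1/2 \<le> \<alpha>" and f: "f \<in> borel_measurable lebesgue" and g: "g \<in> borel_measurable lebesgue"
    and exps: "1 \<le> p1" "1 \<le> p2" "1 \<le> p" "inv_exp p = inv_exp p1 + inv_exp p2 - 1"
  shows "Lp (cell_prob \<alpha> k) p (\<lambda>x. \<integral>\<^sup>+y. f y * hyp_trans_nn \<alpha> g y x \<partial>bk_measure \<alpha>)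
    \<le> amalgam_conv \<alpha> (\<lambda>m. Lp (cell_prob \<alpha> m) p1 f) (\<lambda>n. Lp (cell_prob \<alpha> n) p2 g) k"
    (is "Lp _ p ?S \<le> ?D")
proof -
  have pos: "?S x = bk_cell_sum \<alpha> f g x" if "0 < x" for x
    unfolding bk_cell_sum_def by (rule hyp_conv_nn_eq_sum[OF a that f g])
  note le = bk_cell_sum_Lp_le[OF a f g exps, of k]
  show ?thesis
  proof (cases "p = \<infinity>")
    case False
    have "AE x in cell_prob \<alpha> k. ?S x \<le> bk_cell_sum \<alpha> f g x"
      using AE_cell_prob_pos by eventually_elim (simp add: pos)
    from Lp_mono_AE[OF False this] le show ?thesis by (rule order_trans)
  next
    case True
    have "?S x \<le> ?D" if x: "x \<in> cell k" for x
    proof (cases "x = 0")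
      case True
      then have k: "k = 0" using x by (auto simp: cell_def)
      show ?thesis unfolding True k
        using exps \<open>p = \<infinity>\<close> by (intro hyp_conv_nn_at_0_le[OF a f g]) (auto simp: inv_exp_def)
    next
      case False
      then have "0 < x" using x by (auto simp: cell_def)
      then have "?S x \<le> Lp (cell_prob \<alpha> k) p (bk_cell_sum \<alpha> f g)"
        using \<open>p = \<infinity>\<close> x by (auto simp: pos Lp_top intro!: SUP_upper)
      then show ?thesis using le by (rule order_trans)
    qed
    then show ?thesis using True by (auto simp: Lp_top intro!: SUP_least)
  qed
qed

section \<open>Young's inequality for sequences weighted by the cell masses\<close>

lemma measurable_cell_count3:
  "h \<in> borel_measurable (cell_count \<alpha> \<Otimes>\<^sub>M (cell_count \<alpha> \<Otimes>\<^sub>M cell_count \<alpha>))"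
proof -
  have "sets (cell_count \<alpha> \<Otimes>\<^sub>M (cell_count \<alpha> \<Otimes>\<^sub>M cell_count \<alpha>))
     = sets (count_space (UNIV :: nat set) \<Otimes>\<^sub>M (count_space (UNIV :: nat set) \<Otimes>\<^sub>M count_space (UNIV :: nat set)))"
    by (intro sets_pair_measure_cong sets_cell_count)
  also have "\<dots> = sets (count_space UNIV)"
    by (subst pair_measure_countable, simp, simp, subst pair_measure_countable) simp_all
  finally have eq: "sets (cell_count \<alpha> \<Otimes>\<^sub>M (cell_count \<alpha> \<Otimes>\<^sub>M cell_count \<alpha>)) = sets (count_space UNIV)" .
  show ?thesis
    unfolding measurable_cong_sets[OF eq refl] by simp
qed

lemma amalgam_conv_Lp_le:
  assumes a: "1/2 \<le> \<alpha>"
    and exps: "1 \<le> q1" "1 \<le> q2" "1 \<le> q" "inv_exp q = inv_exp q1 + inv_exp q2 - 1"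
  shows "Lp (cell_count \<alpha>) q (amalgam_conv \<alpha> u v)
     \<le> ennreal (6 * tri_const \<alpha>) * Lp (cell_count \<alpha>) q1 u * Lp (cell_count \<alpha>) q2 v"
proof -
  let ?K = "\<lambda>k m n. ennreal (tri_const \<alpha> * tri_weight \<alpha> (real k + 1) (real m + 1) (real n + 1))"
  have bound: "(\<integral>\<^sup>+n. ?K k m n \<partial>cell_count \<alpha>) \<le> ennreal (6 * tri_const \<alpha>)" for k m
  proof -
    have "(\<integral>\<^sup>+n. ?K k m n \<partial>cell_count \<alpha>)
      = (\<Sum>n. ennreal (tri_const \<alpha>) * (cell_meas \<alpha> n * ennreal (tri_weight \<alpha> (real k + 1) (real m + 1) (real n + 1))))"
      unfolding nn_integral_cell_count using tri_const_pos[OF a] tri_weight_nonneg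
      by (intro suminf_cong) (simp add: ennreal_mult mult.left_commute)
    also have "\<dots> = ennreal (tri_const \<alpha>) *
        (\<Sum>n. cell_meas \<alpha> n * ennreal (tri_weight \<alpha> (real k + 1) (real m + 1) (real n + 1)))"
      by simp
    also have "\<dots> \<le> ennreal (tri_const \<alpha>) * 6"
      by (intro mult_left_mono tri_weight_sum_le[OF a]) auto
    also have "\<dots> = ennreal (6 * tri_const \<alpha>)"
      using tri_const_pos[OF a] by (simp add: ennreal_mult mult.commute)
    finally show ?thesis .
  qed
  have sym: "?K k m n = ?K k n m" "?K k m n = ?K m n k" for k m n
    by (metis tri_weight_swap12 tri_weight_swap23)+
  show ?thesis unfolding amalgam_conv_def[abs_def]
  proof (rule Young_kernel[OF sigma_finite_cell_count[OF a] sigma_finite_cell_count[OF a]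
        sigma_finite_cell_count[OF a] measurable_cell_count3 _ _ _ _ _ _ _ exps])
    show "(\<integral>\<^sup>+n. ?K k m n \<partial>cell_count \<alpha>) \<le> ennreal (6 * tri_const \<alpha>)" for k m by (rule bound)
    show "(\<integral>\<^sup>+m. ?K k m n \<partial>cell_count \<alpha>) \<le> ennreal (6 * tri_const \<alpha>)" for k n
      using bound[of k n] by (simp only: sym(1)[of k n])
    show "(\<integral>\<^sup>+k. ?K k m n \<partial>cell_count \<alpha>) \<le> ennreal (6 * tri_const \<alpha>)" for m n
      using bound[of m n] by (simp only: sym(2)[of _ m n])
  qed (use tri_const_pos[OF a] in \<open>auto simp: measurable_cong_sets[OF sets_cell_count refl]\<close>)
qed

section \<open>Pointwise and almost-everywhere finiteness from finite norms\<close>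

lemma Lp_cell_count_finite_imp:
  assumes a: "1/2 \<le> \<alpha>" and "1 \<le> q" and fin: "Lp (cell_count \<alpha>) q d < \<infinity>"
  shows "d k < \<infinity>"
proof (cases "q = \<infinity>")
  case True
  have "d k \<le> Lp (cell_count \<alpha>) q d" using True by (auto simp: Lp_top intro: SUP_upper)
  then show ?thesis using fin by (rule le_less_trans)
next
  case False
  then have "(\<Sum>n. cell_meas \<alpha> n * epow (d n) (enn2real q)) < top"
    using fin by (simp add: Lp_finite nn_integral_cell_count less_top[symmetric])
  moreover have "(\<Sum>n\<in>{k}. cell_meas \<alpha> n * epow (d n) (enn2real q)) \<le> (\<Sum>n. cell_meas \<alpha> n * epow (d n) (enn2real q))"
    by (rule sum_le_suminf) auto
  ultimately have "cell_meas \<alpha> k * epow (d k) (enn2real q) < top"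
    by (simp add: le_less_trans)
  then show ?thesis
    using cell_meas_pos[OF a, of k] by (auto simp: ennreal_mult_less_top less_top[symmetric])
qed

lemma Lp_finite_imp_AE:
  assumes [measurable]: "f \<in> borel_measurable M" and "Lp M p f < \<infinity>"
  shows "AE x in M. f x < \<infinity>"
proof (cases "p = \<infinity>")
  case True
  have "f x < \<infinity>" if "x \<in> space M" for x
    using assms(2) True that by (auto simp: Lp_top intro: le_less_trans[OF SUP_upper])
  then show ?thesis by (intro AE_I2)
next
  case False
  then have "(\<integral>\<^sup>+x. epow (f x) (enn2real p) \<partial>M) \<noteq> \<infinity>"
    using assms(2) by (simp add: Lp_finite less_top[symmetric])
  then have "AE x in M. epow (f x) (enn2real p) \<noteq> \<infinity>"
    by (intro nn_integral_PInf_AE) measurable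
  then show ?thesis by (simp add: less_top[symmetric])
qed

lemma AE_bk_measure_cells:
  assumes a: "1/2 \<le> \<alpha>" and [measurable]: "Measurable.pred lebesgue P"
    and ae: "\<And>k. AE x in cell_prob \<alpha> k. P x"
  shows "AE x in bk_measure \<alpha>. P x"
proof -
  have [measurable]: "(\<lambda>x. indicator {x. \<not> P x} x :: ennreal) \<in> borel_measurable lebesgue"
    by measurable
  have "(\<integral>\<^sup>+x. indicator {x. \<not> P x} x \<partial>bk_measure \<alpha>)
     = (\<Sum>k. cell_meas \<alpha> k * (\<integral>\<^sup>+x. indicator {x. \<not> P x} x \<partial>cell_prob \<alpha> k))"
    by (rule nn_integral_bk_measure_cells[OF a]) measurable
  also have "\<dots> = (\<Sum>k. cell_meas \<alpha> k * (\<integral>\<^sup>+x. 0 \<partial>cell_prob \<alpha> k))"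
  proof (intro suminf_cong arg_cong2[where f = "(*)"] refl nn_integral_cong_AE)
    fix k show "AE x in cell_prob \<alpha> k. (indicator {x. \<not> P x} x :: ennreal) = 0"
      using ae[of k] by eventually_elim simp
  qed
  finally have "(\<integral>\<^sup>+x. indicator {x. \<not> P x} x \<partial>bk_measure \<alpha>) = 0"
    by simp
  then have "AE x in bk_measure \<alpha>. (indicator {x. \<not> P x} x :: ennreal) = 0"
    by (subst (asm) nn_integral_0_iff_AE) measurable
  then show ?thesis by eventually_elim (simp add: indicator_def split: if_splits)
qed

text \<open>Valid without integrability, because the Bochner integral of a non-integrable function
  is 0. Norm bounds for translation and convolution can thus precede any proof of absolute
  convergence.\<close>

lemma norm_integral_le_nn_integral:
  fixes f :: "'a \<Rightarrow> 'b::{banach, second_countable_topology}"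
  shows "ennreal (norm (integral\<^sup>L M f)) \<le> (\<integral>\<^sup>+x. ennreal (norm (f x)) \<partial>M)"
  using integral_norm_bound_ennreal[of M f] by (cases "integrable M f") (auto simp: not_integrable_integral_eq)

lemma norm_hyp_trans_le:
  assumes a: "1/2 \<le> \<alpha>"
  shows "ennreal (norm (hyp_trans \<alpha> f y x)) \<le> hyp_trans_nn \<alpha> (\<lambda>z. ennreal (norm (f z))) y x"
proof (cases "x = 0 \<or> y = 0")
  case False
  have nn: "0 \<le> indicator {\<bar>y - x\<bar>..y + x} z * bk_kernel \<alpha> y x z * z powr (2 * \<alpha> + 1)" for z
    using tri_kernel_nonneg[OF a, of y x z] by (simp add: tri_kernel_def)
  have "hyp_trans \<alpha> f y x =
      (\<integral>z. (indicator {\<bar>y - x\<bar>..y + x} z * bk_kernel \<alpha> y x z * z powr (2 * \<alpha> + 1)) *\<^sub>R f z \<partial>lebesgue)"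
    using False by (simp add: hyp_trans_def)
  then have "ennreal (norm (hyp_trans \<alpha> f y x)) \<le>
    (\<integral>\<^sup>+z. ennreal (norm ((indicator {\<bar>y - x\<bar>..y + x} z * bk_kernel \<alpha> y x z * z powr (2 * \<alpha> + 1)) *\<^sub>R f z)) \<partial>lebesgue)"
    by (simp only: norm_integral_le_nn_integral)
  also have "\<dots> = (\<integral>\<^sup>+z. ennreal (indicator {\<bar>y - x\<bar>..y + x} z * bk_kernel \<alpha> y x z * z powr (2 * \<alpha> + 1))
      * ennreal (norm (f z)) \<partial>lebesgue)"
    by (simp only: norm_scaleR abs_of_nonneg[OF nn] ennreal_mult[OF nn norm_ge_zero])
  also have "\<dots> = hyp_trans_nn \<alpha> (\<lambda>z. ennreal (norm (f z))) y x"
    using False by (simp add: hyp_trans_nn_def)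
  finally show ?thesis .
qed (auto simp: hyp_trans_def hyp_trans_nn_def)

lemma norm_bk_conv_le:
  assumes a: "1/2 \<le> \<alpha>" and "0 \<le> x"
  shows "ennreal (norm (bk_conv \<alpha> f g x))
    \<le> (\<integral>\<^sup>+y. ennreal (norm (f y)) * hyp_trans_nn \<alpha> (\<lambda>z. ennreal (norm (g z))) y x \<partial>bk_measure \<alpha>)"
proof -
  have "ennreal (norm (bk_conv \<alpha> f g x)) \<le> (\<integral>\<^sup>+y. ennreal (norm (f y * hyp_trans \<alpha> g y x)) \<partial>bk_measure \<alpha>)"
    using assms(2) norm_integral_le_nn_integral by (simp add: bk_conv_def)
  also have "\<dots> \<le> (\<integral>\<^sup>+y. ennreal (norm (f y)) * hyp_trans_nn \<alpha> (\<lambda>z. ennreal (norm (g z))) y x \<partial>bk_measure \<alpha>)"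
    by (intro nn_integral_mono)
       (simp add: norm_mult ennreal_mult mult_left_mono norm_hyp_trans_le[OF a])
  finally show ?thesis .
qed

text \<open>Joint measurability is established before each parametric integral. The kernel is Borel,
  so its coordinates are projected to \<open>borel\<close>; \<open>f\<close> and \<open>g\<close>
  are only Lebesgue measurable and need projections into the completed sigma-algebra.\<close>

lemma bk_conv_measurable:
  assumes f [measurable]: "f \<in> borel_measurable lebesgue" and g [measurable]: "g \<in> borel_measurable lebesgue"
  shows "bk_conv \<alpha> f g \<in> borel_measurable lebesgue"
proof -
  let ?Q = "lebesgue \<Otimes>\<^sub>M bk_measure \<alpha>"
  have idbk: "(\<lambda>x. x) \<in> bk_measure \<alpha> \<rightarrow>\<^sub>M (borel :: real measure)"
    by (simp add: measurable_cong_sets[OF sets_bk_measure refl])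
  have x1 [measurable]: "fst \<in> ?Q \<rightarrow>\<^sub>M (borel :: real measure)"
    by (rule measurable_compose[OF measurable_fst measurable_lebesgue_ident])
  have y1 [measurable]: "snd \<in> ?Q \<rightarrow>\<^sub>M (borel :: real measure)"
    by (rule measurable_compose[OF measurable_snd idbk])
  have "(\<lambda>r. fst (fst r)) \<in> ?Q \<Otimes>\<^sub>M lebesgue \<rightarrow>\<^sub>M (borel :: real measure)"
    by (rule measurable_compose[OF measurable_fst x1])
  moreover have "(\<lambda>r. snd (fst r)) \<in> ?Q \<Otimes>\<^sub>M lebesgue \<rightarrow>\<^sub>M (borel :: real measure)"
    by (rule measurable_compose[OF measurable_fst y1])
  moreover have zm: "snd \<in> ?Q \<Otimes>\<^sub>M lebesgue \<rightarrow>\<^sub>M (borel :: real measure)"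
    by (rule measurable_compose[OF measurable_snd measurable_lebesgue_ident])
  ultimately have tup: "(\<lambda>r. (snd (fst r), fst (fst r), snd r)) \<in> ?Q \<Otimes>\<^sub>M lebesgue \<rightarrow>\<^sub>M borel \<Otimes>\<^sub>M (borel \<Otimes>\<^sub>M borel)"
    by measurable
  have km [measurable]: "(\<lambda>r. tri_kernel \<alpha> (snd (fst r)) (fst (fst r)) (snd r)) \<in> borel_measurable (?Q \<Otimes>\<^sub>M lebesgue)"
    using measurable_compose[OF tup tri_kernel_measurable] by simp
  have [measurable]: "(\<lambda>r. snd r powr (2 * \<alpha> + 1)) \<in> borel_measurable (?Q \<Otimes>\<^sub>M lebesgue)"
    using zm by measurable
  have "(\<lambda>r. (tri_kernel \<alpha> (snd (fst r)) (fst (fst r)) (snd r) * snd r powr (2 * \<alpha> + 1)) *\<^sub>R g (snd r))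
      \<in> borel_measurable (?Q \<Otimes>\<^sub>M lebesgue)"
    by measurable
  then have [measurable]: "(\<lambda>r. \<integral>z. (tri_kernel \<alpha> (snd r) (fst r) z * z powr (2 * \<alpha> + 1)) *\<^sub>R g z \<partial>lebesgue)
      \<in> borel_measurable ?Q"
    by (intro lebesgue.borel_measurable_lebesgue_integral) (simp add: case_prod_beta')
  have "(\<lambda>q. f (snd q) * hyp_trans \<alpha> g (snd q) (fst q)) \<in> borel_measurable ?Q"
  proof -
    have [measurable]: "{r \<in> space ?Q. snd r = 0} \<in> sets ?Q" "{r \<in> space ?Q. fst r = 0} \<in> sets ?Q"
      by measurable
    have "(\<lambda>q. f (snd q) * (if snd q = 0 then g (fst q) else if fst q = 0 then g (snd q)
       else (\<integral>z. (tri_kernel \<alpha> (snd q) (fst q) z * z powr (2 * \<alpha> + 1)) *\<^sub>R g z \<partial>lebesgue))) \<in> borel_measurable ?Q"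
      by measurable
    then show ?thesis unfolding hyp_trans_def tri_kernel_def .
  qed
  then have "(\<lambda>x. \<integral>y. f y * hyp_trans \<alpha> g y x \<partial>bk_measure \<alpha>) \<in> borel_measurable lebesgue"
    by (intro bk.borel_measurable_lebesgue_integral) (simp add: case_prod_beta')
  then show ?thesis
    unfolding bk_conv_def[abs_def] by measurable
qed

theorem mainTheorem7:
  fixes \<alpha> :: real and p1 q1 p2 q2 p q :: ennreal
  assumes "\<alpha> \<ge> 1/2"
    and "1 \<le> p1" "1 \<le> q1" "1 \<le> p2" "1 \<le> q2" "1 \<le> p" "1 \<le> q"
    and "inv_exp p = inv_exp p1 + inv_exp p2 - 1"
    and "inv_exp q = inv_exp q1 + inv_exp q2 - 1"
  shows "\<exists>C>0. \<forall>f1 f2. in_amalgam \<alpha> p1 q1 f1 \<longrightarrow> in_amalgam \<alpha> p2 q2 f2 \<longrightarrow>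
           (AE x in bk_measure \<alpha>.
              (\<integral>\<^sup>+ y. ennreal (norm (f1 y)) * hyp_trans_nn \<alpha> (\<lambda>z. ennreal (norm (f2 z))) y x
                 \<partial>bk_measure \<alpha>) < \<infinity>)
         \<and> in_amalgam \<alpha> p q (bk_conv \<alpha> f1 f2)
         \<and> amalgam_norm \<alpha> p q (bk_conv \<alpha> f1 f2)
             \<le> ennreal C * amalgam_norm \<alpha> p1 q1 f1 * amalgam_norm \<alpha> p2 q2 f2"
proof (intro exI[of _ "6 * tri_const \<alpha>"] conjI allI impI)
  note a = assms(1)
  note pexps = assms(2,4,6,8) and qexps = assms(3,5,7,9)
  show "0 < 6 * tri_const \<alpha>" using tri_const_pos[OF a] by simp
  fix f1 f2 :: "real \<Rightarrow> complex"
  assume in1: "in_amalgam \<alpha> p1 q1 f1" and in2: "in_amalgam \<alpha> p2 q2 f2"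
  then have m1 [measurable]: "f1 \<in> borel_measurable lebesgue" and m2 [measurable]: "f2 \<in> borel_measurable lebesgue"
    and fin: "amalgam_norm \<alpha> p1 q1 f1 < \<infinity>" "amalgam_norm \<alpha> p2 q2 f2 < \<infinity>"
    by (auto simp: in_amalgam_def)
  define f where "f y = ennreal (norm (f1 y))" for y
  define g where "g y = ennreal (norm (f2 y))" for y
  have f [measurable]: "f \<in> borel_measurable lebesgue" and g [measurable]: "g \<in> borel_measurable lebesgue"
    unfolding f_def g_def by measurable
  define S where "S x = (\<integral>\<^sup>+y. f y * hyp_trans_nn \<alpha> g y x \<partial>bk_measure \<alpha>)" for x
  \<comment> \<open>\<open>D\<close> majorises the local norms of the convolution cell by cell; its
    sequence norm gives the estimate, and its finite entries give absolute convergence.\<close>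
  define D where "D = amalgam_conv \<alpha> (\<lambda>m. Lp (cell_prob \<alpha> m) p1 f) (\<lambda>n. Lp (cell_prob \<alpha> n) p2 g)"
  have norms: "amalgam_norm \<alpha> p1 q1 f1 = Lp (cell_count \<alpha>) q1 (\<lambda>n. Lp (cell_prob \<alpha> n) p1 f)"
     "amalgam_norm \<alpha> p2 q2 f2 = Lp (cell_count \<alpha>) q2 (\<lambda>n. Lp (cell_prob \<alpha> n) p2 g)"
    by (simp_all add: amalgam_norm_eq_Lp m1 m2 f_def[abs_def] g_def[abs_def])
  have D_le: "Lp (cell_count \<alpha>) q D \<le> ennreal (6 * tri_const \<alpha>) * amalgam_norm \<alpha> p1 q1 f1 * amalgam_norm \<alpha> p2 q2 f2"
    unfolding D_def norms by (rule amalgam_conv_Lp_le[OF a qexps])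
  have rhs: "ennreal (6 * tri_const \<alpha>) * amalgam_norm \<alpha> p1 q1 f1 * amalgam_norm \<alpha> p2 q2 f2 < \<infinity>"
    using fin by (simp add: ennreal_mult_less_top)
  have D_fin: "D k < \<infinity>" for k
    by (rule Lp_cell_count_finite_imp[OF a assms(7)]) (rule le_less_trans[OF D_le rhs])
  have conv_m: "bk_conv \<alpha> f1 f2 \<in> borel_measurable lebesgue" by (rule bk_conv_measurable[OF m1 m2])
  have "amalgam_norm \<alpha> p q (bk_conv \<alpha> f1 f2)
      = Lp (cell_count \<alpha>) q (\<lambda>n. Lp (cell_prob \<alpha> n) p (\<lambda>x. ennreal (norm (bk_conv \<alpha> f1 f2 x))))"
    by (rule amalgam_norm_eq_Lp[OF conv_m])
  also have "\<dots> \<le> Lp (cell_count \<alpha>) q D"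
  proof (intro Lp_mono)
    fix k
    have "Lp (cell_prob \<alpha> k) p (\<lambda>x. ennreal (norm (bk_conv \<alpha> f1 f2 x))) \<le> Lp (cell_prob \<alpha> k) p S"
      unfolding S_def f_def g_def by (intro Lp_mono norm_bk_conv_le[OF a]) (auto simp: cell_def)
    also have "\<dots> \<le> D k"
      unfolding S_def D_def by (rule hyp_conv_nn_Lp_le[OF a f g pexps])
    finally show "Lp (cell_prob \<alpha> k) p (\<lambda>x. ennreal (norm (bk_conv \<alpha> f1 f2 x))) \<le> D k" .
  qed
  also note D_le
  finally show le: "amalgam_norm \<alpha> p q (bk_conv \<alpha> f1 f2)
      \<le> ennreal (6 * tri_const \<alpha>) * amalgam_norm \<alpha> p1 q1 f1 * amalgam_norm \<alpha> p2 q2 f2" .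
  show "in_amalgam \<alpha> p q (bk_conv \<alpha> f1 f2)"
    unfolding in_amalgam_def using conv_m le_less_trans[OF le rhs] by simp
  \<comment> \<open>The almost-everywhere argument is carried out for \<open>bk_cell_sum\<close>,
    whose measurability is at hand, and transferred to the convolution integral, with which it
    agrees for positive x.\<close>
  note sum_m = bk_cell_sum_measurable[OF a f g]
  have "AE x in bk_measure \<alpha>. bk_cell_sum \<alpha> f g x < \<infinity>"
  proof (rule AE_bk_measure_cells[OF a])
    show "Measurable.pred lebesgue (\<lambda>x. bk_cell_sum \<alpha> f g x < \<infinity>)"
      using sum_m by measurable
    fix k
    show "AE x in cell_prob \<alpha> k. bk_cell_sum \<alpha> f g x < \<infinity>"
      using bk_cell_sum_Lp_le[OF a f g pexps, of k] D_fin[of k] unfolding D_def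
      by (intro Lp_finite_imp_AE measurable_cell_prob[OF sum_m]) (rule le_less_trans)
  qed
  with AE_bk_measure_pos[of \<alpha>]
  show "AE x in bk_measure \<alpha>. (\<integral>\<^sup>+ y. ennreal (norm (f1 y)) * hyp_trans_nn \<alpha> (\<lambda>z. ennreal (norm (f2 z))) y x
                 \<partial>bk_measure \<alpha>) < \<infinity>"
  proof eventually_elim
    case (elim x)
    then show ?case
      using hyp_conv_nn_eq_sum[OF a elim(1) f g] by (simp add: bk_cell_sum_def f_def[abs_def] g_def[abs_def])
  qed
qed

end
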